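(* Let $d\in\mathbb{N}$, let $\Lambda\subset[0,\infty)$ be an additive semigroup with $0\in\Lambda$, and let $\omega$ be an admissible weight on $\Lambda$. A function $f\in\mathcal{D}(\Lambda,\omega,M_d(\mathbb{H}))$ has an inverse in $\mathcal{D}(\Lambda,\omega,M_d(\mathbb{H}))$ if and only if $\overline{\{f(s):s\in\mathcal{H}\}}\subset GL_d(\mathbb{H})$.
   Context: $\mathcal{H}=\{s\in\mathbb C:\operatorname{Re}s\geq 0\}$ (the right half plane; the exponentials $e^{-\lambda s}$ are real-scalar-valued only up to the phase, and in $\mathbb H$ the complex scalar $e^{-\lambda s}$ is interpreted via a fixed imaginary unit, commuting as a scalar as in the paper's setup). $\mathbb H$ is the real algebra of quaternions $x_0+x_1e_1+x_2e_2+x_3e_3$ with $e_1^2=e_2^2=e_3^2=e_1e_2e_3=-1$ and norm $\sqrt{x_0^2+x_1^2+x_2^2+x_3^2}$. $M_d(\mathbb H)$ is the real Banach algebra of $d\times d$ quaternionic matrices with the operator norm as operators on $\mathbb H^{d\times1}$; $GL_d(\mathbb H)$ its invertible elements. A weight on $\Lambda$ is $\omega:\Lambda\to[1,\infty)$ with $\omega(0)=1$, $\omega(\lambda_1+\lambda_2)\le\omega(\lambda_1)\omega(\lambda_2)$; admissible if $\lim_{n\to\infty}\omega(n\lambda)^{1/n}=1$ for all $\lambda$. For a unital Banach algebra $\mathcal A$, $\mathcal D(\Lambda,\omega,\mathcal A)$ is the set of $f:\mathcal H\to\mathcal A$, $f(s)=\sum_{\lambda\in\Lambda}f_\lambda e^{-\lambda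 s}$ with $f_\lambda\in\mathcal A$ and $\sum_\lambda\|f_\lambda\|\omega(\lambda)<\infty$, a unital Banach algebra under pointwise multiplication.
   Formalization: e^{-λs} is a central complex scalar: values f(s) lie in M_d(H)⊗C and GL_d(H) means its invertible elements (with i embedded as e1 the claim fails for e2+e^{-s}); quaternion products are stored with coordinates cyclically shifted, leaving norms and inverses unchanged. *)

theory Defs
  imports "HOL-Analysis.Analysis"
begin

text \<open>A quaternion x0 + x1 e1 + x2 e2 + x3 e3 is represented by its coordinate
vector in real^4; the Euclidean norm of real^4 is the quaternion norm.\<close>

type_synonym quat = "real^4"

definition qmult :: "quat \<Rightarrow> quat \<Rightarrow> quat" where
  "qmult a b = vector
     [a$0*b$0 - a$1*b$1 - a$2*b$2 - a$3*b$3,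
      a$0*b$1 + a$1*b$0 + a$2*b$3 - a$3*b$2,
      a$0*b$2 - a$1*b$3 + a$2*b$0 + a$3*b$1,
      a$0*b$3 + a$1*b$2 - a$2*b$1 + a$3*b$0]"

definition qone :: quat where "qone = vector [1, 0, 0, 0]"

type_synonym 'd qmat = "quat^'d^'d"
type_synonym 'd qvec = "quat^'d"

definition qmat_vec :: "'d::finite qmat \<Rightarrow> 'd qvec \<Rightarrow> 'd qvec" where
  "qmat_vec A v = (\<chi> i. \<Sum>j\<in>UNIV. qmult (A$i$j) (v$j))"

definition qmat_mult :: "'d::finite qmat \<Rightarrow> 'd qmat \<Rightarrow> 'd qmat" where
  "qmat_mult A B = (\<chi> i j. \<Sum>k\<in>UNIV. qmult (A$i$k) (B$k$j))"

definition qmat_id :: "'d::finite qmat" where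
  "qmat_id = (\<chi> i j. if i = j then qone else 0)"

definition qmat_norm :: "'d::finite qmat \<Rightarrow> real" where
  "qmat_norm A = onorm (qmat_vec A)"

text \<open>The value e^(-lambda s) is a complex scalar commuting with all quaternionic
matrices; the values of a Dirichlet series therefore live in M_d(H) tensor C,
represented as pairs (A, B) standing for A + i B with i central.\<close>

type_synonym 'd cqmat = "'d qmat \<times> 'd qmat"

definition cq_mult :: "'d::finite cqmat \<Rightarrow> 'd cqmat \<Rightarrow> 'd cqmat" where
  "cq_mult X Y = (qmat_mult (fst X) (fst Y) - qmat_mult (snd X) (snd Y),
                  qmat_mult (fst X) (snd Y) + qmat_mult (snd X) (fst Y))"

definition cq_one :: "'d::finite cqmat" where "cq_one = (qmat_id, 0)"

definition cq_invertible :: "'d::finite cqmat \<Rightarrow> bool" where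
  "cq_invertible X \<longleftrightarrow> (\<exists>Y. cq_mult X Y = cq_one \<and> cq_mult Y X = cq_one)"

definition right_half_plane :: "complex set" where
  "right_half_plane = {s. Re s \<ge> 0}"

definition additive_semigroup :: "real set \<Rightarrow> bool" where
  "additive_semigroup \<Lambda> \<longleftrightarrow> \<Lambda> \<subseteq> {0..} \<and> 0 \<in> \<Lambda> \<and> (\<forall>x\<in>\<Lambda>. \<forall>y\<in>\<Lambda>. x + y \<in> \<Lambda>)"

definition weight :: "real set \<Rightarrow> (real \<Rightarrow> real) \<Rightarrow> bool" where
  "weight \<Lambda> \<omega> \<longleftrightarrow> (\<forall>l\<in>\<Lambda>. \<omega> l \<ge> 1) \<and> \<omega> 0 = 1 \<and>
     (\<forall>x\<in>\<Lambda>. \<forall>y\<in>\<Lambda>. \<omega> (x + y) \<le> \<omega> x * \<omega> y)"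

definition admissible_weight :: "real set \<Rightarrow> (real \<Rightarrow> real) \<Rightarrow> bool" where
  "admissible_weight \<Lambda> \<omega> \<longleftrightarrow> weight \<Lambda> \<omega> \<and>
     (\<forall>l\<in>\<Lambda>. (\<lambda>n. \<omega> (real n * l) powr (1 / real n)) \<longlonglongrightarrow> 1)"

definition D_coeffs :: "real set \<Rightarrow> (real \<Rightarrow> real) \<Rightarrow> (real \<Rightarrow> 'd::finite qmat) set" where
  "D_coeffs \<Lambda> \<omega> = {a. (\<forall>l. l \<notin> \<Lambda> \<longrightarrow> a l = 0) \<and>
                        (\<lambda>l. qmat_norm (a l) * \<omega> l) summable_on \<Lambda>}"

definition dirichlet_eval :: "real set \<Rightarrow> (real \<Rightarrow> 'd::finite qmat) \<Rightarrow> complex \<Rightarrow> 'd cqmat" where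
  "dirichlet_eval \<Lambda> a s =
     ((\<Sum>\<^sub>\<infinity>l\<in>\<Lambda>. Re (exp (- (complex_of_real l * s))) *\<^sub>R a l),
      (\<Sum>\<^sub>\<infinity>l\<in>\<Lambda>. Im (exp (- (complex_of_real l * s))) *\<^sub>R a l))"

definition D_alg :: "real set \<Rightarrow> (real \<Rightarrow> real) \<Rightarrow> (complex \<Rightarrow> 'd::finite cqmat) set" where
  "D_alg \<Lambda> \<omega> = {dirichlet_eval \<Lambda> a | a. a \<in> D_coeffs \<Lambda> \<omega>}"

end

theory Submission
  imports Defs "HOL-Complex_Analysis.Conformal_Mappings" "HOL-Real_Asymp.Real_Asymp"
begin

text \<open>
  Complexified quaternionic matrices are represented by complex matrices of size 4d, so that
  invertibility is decided by the determinant, whose restriction to the half plane is a scalar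
  Dirichlet series f. By compactness, the closure condition means that f is bounded away from 0,
  and Cramer's rule reduces the theorem to the scalar case: such an f has an inverse
  with summable weighted coefficients.

  The scalar case follows Newman's proof of Wiener's lemma. If p is a finite partial sum close to
  f and q = p - f, then 1/f is the sum of q^n / p^(n+1), and it suffices to bound the weighted norm
  of p^(-n) by C r^n with 1/r just below the infimum of |p|. The exponents of p generate a semigroup S. For
  large Re s the function p^(-n) is an absolutely convergent Dirichlet series over S. Its
  coefficients are Bohr means over vertical lines; moving the line slightly to the left of the
  imaginary axis, where |p| is still bounded below, shows that they decay like
  r^n e^(-\<epsilon> \<mu>). Since S is finitely generated and the weight is admissible, the
  sum of \<omega>(\<mu>) e^(-\<epsilon> \<mu>) over S is finite. No maximal ideal space is involved.
\<close>

section \<open>Scalar Dirichlet series with weighted summable coefficients\<close>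

text \<open>The coefficients stay behind the quantifier and \<open>N\<close> is only an upper bound
  for their weighted norm, so estimates compose without appeal to uniqueness of coefficients. To the
  left of \<open>Re s = \<sigma>\<close> the values of \<open>g\<close> are arbitrary.\<close>

definition dirichlet_bounded ::
    "real set \<Rightarrow> (real \<Rightarrow> real) \<Rightarrow> real \<Rightarrow> real \<Rightarrow> (complex \<Rightarrow> complex) \<Rightarrow> bool" where
  "dirichlet_bounded \<Lambda> w \<sigma> N g \<longleftrightarrow>
     (\<exists>c. (\<exists>M\<le>N. ((\<lambda>l. norm (c l) * w l) has_sum M) \<Lambda>) \<and>
          (\<forall>s. \<sigma> \<le> Re s \<longrightarrow> ((\<lambda>l. c l * exp (- (of_real l * s))) has_sum g s) \<Lambda>))"

text \<open>\<open>I\<close> is the disjoint union of the fibres of \<open>r\<close>, so iterated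
  summation applies; an empty fibre contributes 0. This collects terms with equal exponent.\<close>

lemma has_sum_group:
  fixes f :: "'i \<Rightarrow> 'a::banach"
  assumes "(f has_sum S) I" "r ` I \<subseteq> L"
  shows "((\<lambda>l. infsum f {i\<in>I. r i = l}) has_sum S) L"
proof -
  have bij: "bij_betw snd (Sigma L (\<lambda>l. {i\<in>I. r i = l})) I"
    by (rule bij_betwI[where g = "\<lambda>i. (r i, i)"]) (use assms(2) in auto)
  have "((\<lambda>p. f (snd p)) has_sum S) (Sigma L (\<lambda>l. {i\<in>I. r i = l}))"
    using has_sum_reindex_bij_betw[OF bij, of f S] assms(1) by simp
  moreover have "((\<lambda>i. f (snd (l, i))) has_sum infsum f {i\<in>I. r i = l}) {i\<in>I. r i = l}" for l
    using assms(1) by (auto intro!: has_sum_infsum summable_on_subset_banach[OF has_sum_imp_summable[OF assms(1)]])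
  ultimately show ?thesis
    by (intro has_sum_SigmaD[where B = "\<lambda>l. {i\<in>I. r i = l}"]) auto
qed

lemma norm_exp_le_weight:
  assumes "exp (- (l * \<sigma>)) \<le> w" "\<sigma> \<le> Re s" "0 \<le> l"
  shows "norm (c * exp (- (of_real l * s))) \<le> norm c * w"
proof -
  have "norm (exp (- (of_real l * s))) = exp (- (l * Re s))"
    by simp
  also have "\<dots> \<le> exp (- (l * \<sigma>))"
    using assms by (simp add: mult_left_mono)
  also have "\<dots> \<le> w"
    by (rule assms(1))
  finally show ?thesis
    by (simp add: norm_mult mult_left_mono del: norm_exp_eq_Re)
qed

text \<open>The general way to exhibit a weighted series. Exponents may repeat in the family, as
  they do for products and for sequences of series; merging the coefficients with equal
  \<open>r i\<close> only lowers the weighted norm, by the triangle inequality on each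
  fibre.\<close>

lemma dirichlet_bounded_family:
  fixes c :: "'i \<Rightarrow> complex"
  assumes r: "r ` I \<subseteq> \<Lambda>" and \<Lambda>: "\<Lambda> \<subseteq> {0..}"
    and w: "\<And>l. l \<in> \<Lambda> \<Longrightarrow> exp (- (l * \<sigma>)) \<le> w l"
    and sum: "((\<lambda>i. norm (c i) * w (r i)) has_sum M) I" "M \<le> N"
    and g: "\<And>s. \<sigma> \<le> Re s \<Longrightarrow> g s = (\<Sum>\<^sub>\<infinity>i\<in>I. c i * exp (- (of_real (r i) * s)))"
  shows "dirichlet_bounded \<Lambda> w \<sigma> N g"
proof -
  define A where "A l = {i\<in>I. r i = l}" for l
  define c' where "c' l = infsum c (A l)" for l
  have wpos: "0 < w l" if "l \<in> \<Lambda>" for l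
    using w[OF that] by (meson exp_gt_zero less_le_trans)
  have sumA: "(\<lambda>i. norm (c i) * w l) summable_on A l" for l
  proof -
    have "(\<lambda>i. norm (c i) * w (r i)) summable_on A l"
      using sum(1) by (rule summable_on_subset[OF has_sum_imp_summable]) (auto simp: A_def)
    then show ?thesis
      by (rule summable_on_cong[THEN iffD1, rotated]) (simp add: A_def)
  qed
  \<comment> \<open>On a fibre the weight is the positive constant \<open>w l\<close> and can be
    cancelled.\<close>
  have nsum: "(\<lambda>i. norm (c i)) summable_on A l" if "l \<in> \<Lambda>" for l
    using sumA[of l] wpos[OF that] by (simp add: summable_on_cmult_left')
  have T: "((\<lambda>l. infsum (\<lambda>i. norm (c i) * w (r i)) (A l)) has_sum M) \<Lambda>"
    unfolding A_def by (rule has_sum_group[OF sum(1) r])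
  have le: "norm (c' l) * w l \<le> infsum (\<lambda>i. norm (c i) * w (r i)) (A l)" if "l \<in> \<Lambda>" for l
  proof -
    have "norm (c' l) * w l \<le> infsum (\<lambda>i. norm (c i)) (A l) * w l"
      using norm_infsum_bound[OF nsum[OF that]] wpos[OF that] by (simp add: c'_def)
    also have "\<dots> = infsum (\<lambda>i. norm (c i) * w l) (A l)"
      by (simp add: infsum_cmult_left')
    also have "\<dots> = infsum (\<lambda>i. norm (c i) * w (r i)) (A l)"
      by (rule infsum_cong) (simp add: A_def)
    finally show ?thesis .
  qed
  have s1: "(\<lambda>l. norm (c' l) * w l) summable_on \<Lambda>"
    by (rule summable_on_comparison_test[OF has_sum_imp_summable[OF T] le]) (auto simp: wpos less_imp_le)
  have M': "infsum (\<lambda>l. norm (c' l) * w l) \<Lambda> \<le> N"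
    using has_sum_mono[OF has_sum_infsum[OF s1] T le] sum(2) by linarith
  have "((\<lambda>l. c' l * exp (- (of_real l * s))) has_sum g s) \<Lambda>" if s: "\<sigma> \<le> Re s" for s
  proof -
    have "(\<lambda>i. norm (c i * exp (- (of_real (r i) * s)))) summable_on I"
      using r \<Lambda> w s
      by (intro Infinite_Sum.abs_summable_on_comparison_test'[OF has_sum_imp_summable[OF sum(1)]] norm_exp_le_weight) auto
    then have "(\<lambda>i. c i * exp (- (of_real (r i) * s))) summable_on I"
      by (rule abs_summable_summable)
    from has_sum_group[OF has_sum_infsum[OF this] r]
    have "((\<lambda>l. infsum (\<lambda>i. c i * exp (- (of_real (r i) * s))) (A l)) has_sum g s) \<Lambda>"
      by (simp add: A_def g[OF s])
    moreover have "infsum (\<lambda>i. c i * exp (- (of_real (r i) * s))) (A l) = c' l * exp (- (of_real l * s))" for l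
    proof -
      have "infsum (\<lambda>i. c i * exp (- (of_real (r i) * s))) (A l) = infsum (\<lambda>i. c i * exp (- (of_real l * s))) (A l)"
        by (rule infsum_cong) (simp add: A_def)
      then show ?thesis
        by (simp add: c'_def infsum_cmult_left')
    qed
    ultimately show ?thesis by simp
  qed
  then show ?thesis
    unfolding dirichlet_bounded_def using M' has_sum_infsum[OF s1] by blast
qed

lemma dirichlet_bounded_cong:
  "dirichlet_bounded \<Lambda> w \<sigma> N g \<Longrightarrow> (\<And>s. \<sigma> \<le> Re s \<Longrightarrow> g s = h s) \<Longrightarrow> dirichlet_bounded \<Lambda> w \<sigma> N h"
  unfolding dirichlet_bounded_def by auto

text \<open>\<open>weight_ge\<close> puts each exponential below its weight on
  \<open>\<sigma> \<le> Re s\<close>, so weighted summability gives absolute convergence there. Two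
  kinds of instance occur: \<open>\<omega>\<close> with \<open>\<sigma> = 0\<close>, and the
  function \<open>exp (- (l * \<sigma>))\<close> itself as weight in a far right half plane.\<close>

locale dirichlet_weight =
  fixes \<Lambda> :: "real set" and w :: "real \<Rightarrow> real" and \<sigma> :: real
  assumes semigroup: "additive_semigroup \<Lambda>"
    and weight_ge: "l \<in> \<Lambda> \<Longrightarrow> exp (- (l * \<sigma>)) \<le> w l"
    and weight_0: "w 0 = 1"
    and weight_add: "l \<in> \<Lambda> \<Longrightarrow> k \<in> \<Lambda> \<Longrightarrow> w (l + k) \<le> w l * w k"
begin

section \<open>Algebra operations and completeness for weighted series\<close>

lemma nonneg: "\<Lambda> \<subseteq> {0..}" and zero_mem: "0 \<in> \<Lambda>"
  and add_mem: "l \<in> \<Lambda> \<Longrightarrow> k \<in> \<Lambda> \<Longrightarrow> l + k \<in> \<Lambda>"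
  using semigroup by (auto simp: additive_semigroup_def)

lemma weight_pos: "l \<in> \<Lambda> \<Longrightarrow> 0 < w l"
  using weight_ge by (meson exp_gt_zero less_le_trans)

lemma dirichlet_bounded_norm_le:
  assumes "dirichlet_bounded \<Lambda> w \<sigma> N g" "\<sigma> \<le> Re s"
  shows "norm (g s) \<le> N"
proof -
  obtain c M where M: "((\<lambda>l. norm (c l) * w l) has_sum M) \<Lambda>" "M \<le> N"
    and g: "((\<lambda>l. c l * exp (- (of_real l * s))) has_sum g s) \<Lambda>"
    using assms unfolding dirichlet_bounded_def by blast
  have le: "norm (c l * exp (- (of_real l * s))) \<le> norm (c l) * w l" if "l \<in> \<Lambda>" for l
    using that nonneg weight_ge assms(2) by (intro norm_exp_le_weight) auto
  have s: "(\<lambda>l. norm (c l * exp (- (of_real l * s)))) summable_on \<Lambda>"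
    by (rule Infinite_Sum.abs_summable_on_comparison_test'[OF has_sum_imp_summable[OF M(1)] le])
  have "norm (g s) \<le> infsum (\<lambda>l. norm (c l * exp (- (of_real l * s)))) \<Lambda>"
    by (rule norm_has_sum_bound[OF has_sum_infsum[OF s] g])
  also have "\<dots> \<le> M"
    by (rule has_sum_mono[OF has_sum_infsum[OF s] M(1) le])
  finally show ?thesis using M(2) by simp
qed

lemma dirichlet_bounded_single:
  assumes "l \<in> \<Lambda>"
  shows "dirichlet_bounded \<Lambda> w \<sigma> (norm c * w l) (\<lambda>s. c * exp (- (of_real l * s)))"
  by (rule dirichlet_bounded_family[where I = "{()}" and r = "\<lambda>_. l" and c = "\<lambda>_. c"])
     (use assms nonneg weight_ge in \<open>auto intro!: has_sum_finiteI\<close>)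

lemma dirichlet_bounded_const: "dirichlet_bounded \<Lambda> w \<sigma> (norm c) (\<lambda>_. c)"
  using dirichlet_bounded_single[OF zero_mem, of c] by (simp add: weight_0)

text \<open>Cauchy product: the family is indexed by pairs \<open>(l, k)\<close> with exponent
  \<open>l + k\<close>, and \<open>weight_add\<close> bounds its norm by the product of the two
  norms.\<close>

lemma dirichlet_bounded_mult:
  assumes "dirichlet_bounded \<Lambda> w \<sigma> N1 g1" "dirichlet_bounded \<Lambda> w \<sigma> N2 g2"
  shows "dirichlet_bounded \<Lambda> w \<sigma> (N1 * N2) (\<lambda>s. g1 s * g2 s)"
proof -
  obtain c1 M1 where c1: "((\<lambda>l. norm (c1 l) * w l) has_sum M1) \<Lambda>" "M1 \<le> N1"
    and g1: "\<And>s. \<sigma> \<le> Re s \<Longrightarrow> ((\<lambda>l. c1 l * exp (- (of_real l * s))) has_sum g1 s) \<Lambda>"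
    using assms(1) unfolding dirichlet_bounded_def by blast
  obtain c2 M2 where c2: "((\<lambda>l. norm (c2 l) * w l) has_sum M2) \<Lambda>" "M2 \<le> N2"
    and g2: "\<And>s. \<sigma> \<le> Re s \<Longrightarrow> ((\<lambda>l. c2 l * exp (- (of_real l * s))) has_sum g2 s) \<Lambda>"
    using assms(2) unfolding dirichlet_bounded_def by blast
  define c where "c = (\<lambda>(l, k). c1 l * c2 k)"
  define r where "r = (\<lambda>(l::real, k::real). l + k)"
  have M0: "0 \<le> M1" "0 \<le> M2"
    by (rule has_sum_nonneg[OF c1(1)] has_sum_nonneg[OF c2(1)]; simp add: weight_pos less_imp_le)+
  have inner: "((\<lambda>k. (norm (c1 l) * w l) * (norm (c2 k) * w k)) has_sum (norm (c1 l) * w l) * M2) \<Lambda>" for l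
    by (rule has_sum_cmult_right[OF c2(1)])
  have outer: "((\<lambda>l. (norm (c1 l) * w l) * M2) has_sum M1 * M2) \<Lambda>"
    by (rule has_sum_cmult_left[OF c1(1)])
  have big: "((\<lambda>(l, k). (norm (c1 l) * w l) * (norm (c2 k) * w k)) has_sum M1 * M2) (\<Lambda> \<times> \<Lambda>)"
  proof (rule has_sum_SigmaI[OF _ outer])
    show "((\<lambda>y. case (l, y) of (l, k) \<Rightarrow> (norm (c1 l) * w l) * (norm (c2 k) * w k)) has_sum (norm (c1 l) * w l) * M2) \<Lambda>" for l
      using inner by simp
    show "(\<lambda>(l, k). (norm (c1 l) * w l) * (norm (c2 k) * w k)) summable_on \<Lambda> \<times> \<Lambda>"
      by (rule summable_on_SigmaI[OF _ has_sum_imp_summable[OF outer]])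
         (use inner in \<open>auto simp: weight_pos less_imp_le\<close>)
  qed
  have le: "norm (c p) * w (r p) \<le> (\<lambda>(l, k). (norm (c1 l) * w l) * (norm (c2 k) * w k)) p"
    if mem: "p \<in> \<Lambda> \<times> \<Lambda>" for p
  proof -
    obtain l k where p: "p = (l, k)" "l \<in> \<Lambda>" "k \<in> \<Lambda>"
      using mem by auto
    have "(norm (c1 l) * norm (c2 k)) * w (l + k) \<le> (norm (c1 l) * norm (c2 k)) * (w l * w k)"
      by (rule mult_left_mono[OF weight_add[OF p(2,3)]]) simp
    then show ?thesis
      by (simp add: p c_def r_def norm_mult mult_ac)
  qed
  have rm: "r ` (\<Lambda> \<times> \<Lambda>) \<subseteq> \<Lambda>"
    by (auto simp: r_def add_mem)
  have s: "(\<lambda>p. norm (c p) * w (r p)) summable_on \<Lambda> \<times> \<Lambda>"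
  proof (rule summable_on_comparison_test[OF has_sum_imp_summable[OF big] le])
    fix p assume "p \<in> \<Lambda> \<times> \<Lambda>"
    then have "r p \<in> \<Lambda>" using rm by blast
    then show "0 \<le> norm (c p) * w (r p)" by (simp add: weight_pos less_imp_le)
  qed
  show ?thesis
  proof (rule dirichlet_bounded_family[OF rm nonneg weight_ge has_sum_infsum[OF s]])
    have "infsum (\<lambda>p. norm (c p) * w (r p)) (\<Lambda> \<times> \<Lambda>) \<le> M1 * M2"
      by (rule has_sum_mono[OF has_sum_infsum[OF s] big le])
    also have "\<dots> \<le> N1 * N2"
      using M0 c1 c2 by (intro mult_mono) auto
    finally show "infsum (\<lambda>p. norm (c p) * w (r p)) (\<Lambda> \<times> \<Lambda>) \<le> N1 * N2" .
    fix t :: complex assume t: "\<sigma> \<le> Re t"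
    have e: "c (l, k) * exp (- (of_real (r (l, k)) * t)) =
        (c1 l * exp (- (of_real l * t))) * (c2 k * exp (- (of_real k * t)))" for l k
    proof -
      have "- (of_real (l + k) * t) = - (of_real l * t) + - (of_real k * t)"
        by (simp add: algebra_simps)
      then show ?thesis
        by (simp only: c_def r_def case_prod_conv exp_add mult_ac)
    qed
    have "norm (c p * exp (- (of_real (r p) * t))) \<le> norm (c p) * w (r p)" if "p \<in> \<Lambda> \<times> \<Lambda>" for p
      using that rm nonneg weight_ge t by (intro norm_exp_le_weight) auto
    then have "(\<lambda>p. c p * exp (- (of_real (r p) * t))) summable_on \<Lambda> \<times> \<Lambda>"
      by (rule abs_summable_summable[OF Infinite_Sum.abs_summable_on_comparison_test'[OF s]])
    then have "((\<lambda>p. c p * exp (- (of_real (r p) * t))) has_sum g1 t * g2 t) (\<Lambda> \<times> \<Lambda>)"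
      by (intro has_sum_SigmaI[where g = "\<lambda>l. (c1 l * exp (- (of_real l * t))) * g2 t"])
         (auto simp: e intro!: has_sum_cmult_right has_sum_cmult_left g1 g2 t)
    then show "g1 t * g2 t = (\<Sum>\<^sub>\<infinity>p\<in>\<Lambda> \<times> \<Lambda>. c p * exp (- (of_real (r p) * t)))"
      by (simp add: infsumI)
  qed auto
qed

lemma dirichlet_bounded_power:
  assumes "dirichlet_bounded \<Lambda> w \<sigma> N g"
  shows "dirichlet_bounded \<Lambda> w \<sigma> (N ^ n) (\<lambda>s. g s ^ n)"
proof (induction n)
  case 0
  show ?case using dirichlet_bounded_const[of 1] by simp
next
  case (Suc n)
  show ?case using dirichlet_bounded_mult[OF assms Suc] by simp
qed

text \<open>Completeness of the weighted norm. The coefficients of all \<open>g n\<close> form one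
  absolutely summable double family: summed over exponents for fixed \<open>n\<close> it gives the
  values \<open>g n s\<close>, and grouped by exponent it gives the new coefficients.\<close>

lemma dirichlet_bounded_suminf:
  fixes g :: "nat \<Rightarrow> complex \<Rightarrow> complex"
  assumes g: "\<And>n. dirichlet_bounded \<Lambda> w \<sigma> (N n) (g n)" and N: "N sums S"
  shows "dirichlet_bounded \<Lambda> w \<sigma> S (\<lambda>s. \<Sum>n. g n s)"
proof -
  have "\<forall>n. \<exists>c M. M \<le> N n \<and> ((\<lambda>l. norm (c l) * w l) has_sum M) \<Lambda> \<and>
      (\<forall>s. \<sigma> \<le> Re s \<longrightarrow> ((\<lambda>l. c l * exp (- (of_real l * s))) has_sum g n s) \<Lambda>)"
    using g unfolding dirichlet_bounded_def by blast
  then obtain c M where MN: "\<And>n. M n \<le> N n"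
    and M: "\<And>n. ((\<lambda>l. norm (c n l) * w l) has_sum M n) \<Lambda>"
    and c: "\<And>n s. \<sigma> \<le> Re s \<Longrightarrow> ((\<lambda>l. c n l * exp (- (of_real l * s))) has_sum g n s) \<Lambda>"
    by metis
  have M0: "0 \<le> M n" for n
    using M by (rule has_sum_nonneg) (simp add: weight_pos less_imp_le)
  \<comment> \<open>The norms \<open>M n\<close> are nonnegative, hence so are the bounds
    \<open>N n\<close>, and the ordered sum is unconditional.\<close>
  have N': "(N has_sum S) UNIV"
    using N order_trans[OF M0 MN] by (rule sums_nonneg_imp_has_sum)
  have Ms: "M summable_on UNIV"
    by (rule summable_on_comparison_test[OF has_sum_imp_summable[OF N']]) (use MN M0 in auto)
  have s: "(\<lambda>p. norm (c (fst p) (snd p)) * w (snd p)) summable_on UNIV \<times> \<Lambda>"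
    by (rule summable_on_SigmaI[OF _ Ms]) (use M in \<open>auto simp: weight_pos less_imp_le\<close>)
  show ?thesis
  proof (rule dirichlet_bounded_family[OF _ nonneg weight_ge has_sum_infsum[OF s]])
    have "(M has_sum infsum (\<lambda>p. norm (c (fst p) (snd p)) * w (snd p)) (UNIV \<times> \<Lambda>)) UNIV"
      by (rule has_sum_SigmaD[OF has_sum_infsum[OF s]]) (use M in auto)
    then show "infsum (\<lambda>p. norm (c (fst p) (snd p)) * w (snd p)) (UNIV \<times> \<Lambda>) \<le> S"
      using N' MN by (rule has_sum_mono)
    fix t :: complex assume t: "\<sigma> \<le> Re t"
    let ?h = "\<lambda>p. c (fst p) (snd p) * exp (- (of_real (snd p) * t))"
    have "norm (?h p) \<le> norm (c (fst p) (snd p)) * w (snd p)" if "p \<in> UNIV \<times> \<Lambda>" for p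
      using that nonneg weight_ge t by (intro norm_exp_le_weight) auto
    then have "?h summable_on UNIV \<times> \<Lambda>"
      by (rule abs_summable_summable[OF Infinite_Sum.abs_summable_on_comparison_test'[OF s]])
    then have "((\<lambda>n. g n t) has_sum infsum ?h (UNIV \<times> \<Lambda>)) UNIV"
      by (intro has_sum_SigmaD[OF has_sum_infsum]) (use c t in auto)
    then show "(\<Sum>n. g n t) = infsum ?h (UNIV \<times> \<Lambda>)"
      by (intro sums_unique[symmetric] has_sum_imp_sums)
  qed auto
qed

text \<open>The case \<open>g1, g2, 0, 0, ...\<close> of a convergent series.\<close>

lemma dirichlet_bounded_add:
  assumes "dirichlet_bounded \<Lambda> w \<sigma> N1 g1" "dirichlet_bounded \<Lambda> w \<sigma> N2 g2"
  shows "dirichlet_bounded \<Lambda> w \<sigma> (N1 + N2) (\<lambda>s. g1 s + g2 s)"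
proof -
  have "dirichlet_bounded \<Lambda> w \<sigma> (if n = 0 then N1 else if n = 1 then N2 else 0)
      (if n = 0 then g1 else if n = 1 then g2 else (\<lambda>_. 0))" for n :: nat
    using assms dirichlet_bounded_const[of 0] by simp
  moreover have "(\<lambda>n::nat. if n = 0 then N1 else if n = 1 then N2 else 0) sums (N1 + N2)"
    using sums_finite[of "{0::nat, 1}" "\<lambda>n. if n = 0 then N1 else if n = 1 then N2 else 0"] by simp
  ultimately have "dirichlet_bounded \<Lambda> w \<sigma> (N1 + N2)
      (\<lambda>s. \<Sum>n. (if n = (0::nat) then g1 else if n = 1 then g2 else (\<lambda>_. 0)) s)"
    by (rule dirichlet_bounded_suminf)
  moreover have "(\<Sum>n. (if n = (0::nat) then g1 else if n = 1 then g2 else (\<lambda>_. 0)) s) = g1 s + g2 s" for s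
    by (subst suminf_finite[of "{0,1}"]) auto
  ultimately show ?thesis by simp
qed

lemma dirichlet_bounded_sum:
  assumes "finite A" "\<And>a. a \<in> A \<Longrightarrow> \<exists>N. dirichlet_bounded \<Lambda> w \<sigma> N (g a)"
  shows "\<exists>N. dirichlet_bounded \<Lambda> w \<sigma> N (\<lambda>s. \<Sum>a\<in>A. g a s)"
  using assms
proof (induction A rule: finite_induct)
  case empty
  show ?case using dirichlet_bounded_const[of 0] by auto
next
  case (insert a A)
  obtain N N' where "dirichlet_bounded \<Lambda> w \<sigma> N (g a)"
    and "dirichlet_bounded \<Lambda> w \<sigma> N' (\<lambda>s. \<Sum>a\<in>A. g a s)"
    using insert.IH insert.prems[of a] insert.prems by blast
  from dirichlet_bounded_add[OF this] insert(1,2) show ?case by auto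
qed

lemma dirichlet_bounded_prod:
  assumes "finite A" "\<And>a. a \<in> A \<Longrightarrow> \<exists>N. dirichlet_bounded \<Lambda> w \<sigma> N (g a)"
  shows "\<exists>N. dirichlet_bounded \<Lambda> w \<sigma> N (\<lambda>s. \<Prod>a\<in>A. g a s)"
  using assms
proof (induction A rule: finite_induct)
  case empty
  show ?case using dirichlet_bounded_const[of 1] by auto
next
  case (insert a A)
  obtain N N' where "dirichlet_bounded \<Lambda> w \<sigma> N (g a)"
    and "dirichlet_bounded \<Lambda> w \<sigma> N' (\<lambda>s. \<Prod>a\<in>A. g a s)"
    using insert.IH insert.prems[of a] insert.prems by blast
  from dirichlet_bounded_mult[OF this] insert(1,2) show ?case by auto
qed

end

section \<open>Coefficient estimates and finitely generated semigroups\<close>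

text \<open>Choosing one preimage of each image point makes \<open>g\<close> injective on the chosen
  subset. This handles semigroup elements with several representations by generators.\<close>

lemma summable_on_image:
  fixes f :: "'b \<Rightarrow> real"
  assumes "(\<lambda>x. f (g x)) summable_on A"
  shows "f summable_on g ` A"
proof -
  define B where "B = inv_into A g ` (g ` A)"
  have "B \<subseteq> A" and inj: "inj_on g B" and img: "g ` B = g ` A"
    by (auto simp: B_def inv_into_into f_inv_into_f image_image intro!: inj_onI)
  have "(\<lambda>x. f (g x)) summable_on B"
    using assms \<open>B \<subseteq> A\<close> by (rule summable_on_subset_banach)
  then show ?thesis
    using summable_on_reindex[OF inj, of f] by (simp add: o_def img)
qed

text \<open>The prescribed set \<open>T0\<close> keeps a chosen exponent out of the small
  tail.\<close>

lemma infsum_tail_small: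
  fixes f :: "'a \<Rightarrow> real"
  assumes "f summable_on S" "finite T0" "T0 \<subseteq> S" "0 < e"
  obtains T where "finite T" "T0 \<subseteq> T" "T \<subseteq> S" "infsum f (S - T) < e"
proof -
  have "(sum f \<longlongrightarrow> infsum f S) (finite_subsets_at_top S)"
    using has_sum_infsum[OF assms(1)] by (simp add: has_sum_def)
  then have "\<forall>\<^sub>F X in finite_subsets_at_top S. dist (sum f X) (infsum f S) < e"
    using assms(4) by (rule tendstoD)
  then obtain X where X: "finite X" "X \<subseteq> S"
    "\<forall>Y. finite Y \<and> X \<subseteq> Y \<and> Y \<subseteq> S \<longrightarrow> dist (sum f Y) (infsum f S) < e"
    unfolding eventually_finite_subsets_at_top by (elim exE conjE)
  define T where "T = X \<union> T0"
  have T: "finite T" "T0 \<subseteq> T" "T \<subseteq> S" and d: "dist (sum f T) (infsum f S) < e"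
    using X assms unfolding T_def by auto
  have "infsum f (T \<union> (S - T)) = infsum f T + infsum f (S - T)"
    using assms(1) T(1) by (intro infsum_Un_disjoint) (auto intro: summable_on_subset_banach)
  moreover have "T \<union> (S - T) = S" using T(3) by auto
  ultimately have "infsum f (S - T) < e"
    using d T(1) by (simp add: dist_real_def)
  with T show ?thesis using that by blast
qed

text \<open>
  Multiplying h by \<open>exp (\<mu> s)\<close> makes the coefficient at \<open>\<mu>\<close> the constant term, that is, the mean
  value over long vertical segments of the line \<open>Re s = \<sigma>\<close>. A primitive on the half plane replaces
  the contour shift to \<open>Re s = \<rho>\<close>: the horizontal displacements contribute a bounded amount, which
  disappears after division by the length of the segment.
\<close>
lemma dirichlet_coefficient_bound:
  fixes h :: "complex \<Rightarrow> complex" and b :: "real \<Rightarrow> complex"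
  assumes hol: "h holomorphic_on {s. a < Re s}" and a: "a < \<rho>" "\<rho> \<le> \<sigma>"
    and bound: "\<And>s. \<rho> \<le> Re s \<Longrightarrow> norm (h s) \<le> M"
    and summable: "(\<lambda>l. norm (b l) * exp (- (l * \<sigma>))) summable_on S"
    and series: "\<And>s. Re s = \<sigma> \<Longrightarrow> ((\<lambda>l. b l * exp (- (of_real l * s))) has_sum h s) S"
    and \<mu>: "\<mu> \<in> S" "0 \<le> \<mu>"
  shows "norm (b \<mu>) \<le> M * exp (\<mu> * \<rho>)"
proof (rule field_le_epsilon)
  fix \<eta> :: real assume \<eta>: "0 < \<eta>"
  define F where "F s = h s * exp (of_real \<mu> * s)" for s
  have M0: "0 \<le> M"
    using bound[of "of_real \<rho>"] order_trans[OF norm_ge_zero] by auto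
  have Fbound: "norm (F s) \<le> M * exp (\<mu> * Re s)" if "\<rho> \<le> Re s" for s
    using bound[OF that] by (simp add: F_def norm_mult mult_right_mono)
  have halfplane: "{s. a < Re s} = {s. Re s > a}" by auto
  have "F holomorphic_on {s. a < Re s}"
    unfolding F_def by (intro holomorphic_intros hol)
  then obtain P where P: "\<And>s. s \<in> {s. a < Re s} \<Longrightarrow> (P has_field_derivative F s) (at s within {s. a < Re s})"
    using holomorphic_convex_primitive'[of "{s. a < Re s}" F]
    by (metis (no_types, lifting) convex_halfspace_Re_gt halfplane open_halfspace_Re_gt)
  have dP: "(P has_field_derivative F s) (at s within A)" if "a < Re s" for s A
    using P[of s] that at_within_open[of s "{s. a < Re s}"] open_halfspace_Re_gt[of a]
    by (auto intro: has_field_derivative_at_within)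
  have cnv: "convex {s. Re s = c}" for c
    by (auto simp: convex_def algebra_simps simp flip: distrib_right)
  \<comment> \<open>The factor \<open>exp (- (\<mu> * \<sigma>))\<close> offsets the growth of
    \<open>exp (\<mu> s)\<close>, so the remainder on \<open>Re s = \<sigma>\<close> is at most
    \<open>\<eta> / 2\<close>.\<close>
  obtain T where T: "finite T" "{\<mu>} \<subseteq> T" "T \<subseteq> S"
    and tail: "infsum (\<lambda>l. norm (b l) * exp (- (l * \<sigma>))) (S - T) < \<eta> / 2 * exp (- (\<mu> * \<sigma>))"
  proof (rule infsum_tail_small[OF summable, of "{\<mu>}" "\<eta> / 2 * exp (- (\<mu> * \<sigma>))"])
    show "{\<mu>} \<subseteq> S" "0 < \<eta> / 2 * exp (- (\<mu> * \<sigma>))"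
      using \<mu>(1) \<eta> by simp_all
  qed auto
  \<comment> \<open>Primitive of the terms in \<open>T\<close> whose exponent
    \<open>\<mu> - l\<close> is nonzero. The term at \<open>\<mu>\<close> is constant and has the
    linear primitive \<open>b \<mu> * s\<close>.\<close>
  define E where "E s = (\<Sum>l\<in>T - {\<mu>}. b l * exp (of_real (\<mu> - l) * s) / of_real (\<mu> - l))" for s
  define Q where "Q s = P s - b \<mu> * s - E s" for s
  define r where "r s = F s - (\<Sum>l\<in>T. b l * exp (of_real (\<mu> - l) * s))" for s
  have dQ: "(Q has_field_derivative r s) (at s within A)" if "a < Re s" for s A
  proof -
    have "(E has_field_derivative (\<Sum>l\<in>T - {\<mu>}. b l * exp (of_real (\<mu> - l) * s))) (at s within A)"
      unfolding E_def
    proof (rule DERIV_sum)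
      fix l assume "l \<in> T - {\<mu>}"
      then have "complex_of_real (\<mu> - l) \<noteq> 0" by simp
      then show "((\<lambda>s. b l * exp (of_real (\<mu> - l) * s) / of_real (\<mu> - l)) has_field_derivative
          b l * exp (of_real (\<mu> - l) * s)) (at s within A)"
        by (auto intro!: derivative_eq_intros simp del: of_real_diff)
    qed
    then have "(Q has_field_derivative F s - b \<mu> - (\<Sum>l\<in>T - {\<mu>}. b l * exp (of_real (\<mu> - l) * s))) (at s within A)"
      unfolding Q_def by (auto intro!: derivative_eq_intros dP that)
    moreover have "(\<Sum>l\<in>T. b l * exp (of_real (\<mu> - l) * s)) =
        b \<mu> + (\<Sum>l\<in>T - {\<mu>}. b l * exp (of_real (\<mu> - l) * s))"
      using T by (subst sum.remove[of T \<mu>]) auto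
    ultimately show ?thesis
      unfolding r_def by (simp add: algebra_simps)
  qed
  have exp_split: "exp (- (of_real l * s)) * exp (of_real \<mu> * s) = exp (of_real (\<mu> - l) * s)" for l and s :: complex
    by (simp add: exp_add[symmetric] algebra_simps)
  have rbound: "norm (r s) \<le> \<eta> / 2" if s: "Re s = \<sigma>" for s
  proof -
    let ?t = "\<lambda>l. b l * exp (of_real (\<mu> - l) * s)"
    have "((\<lambda>l. b l * exp (- (of_real l * s)) * exp (of_real \<mu> * s)) has_sum F s) S"
      unfolding F_def by (rule has_sum_cmult_left[OF series[OF s]])
    then have tS: "(?t has_sum F s) S"
      by (simp only: mult.assoc exp_split)
    have st: "?t summable_on (S - T)"
      by (rule summable_on_subset_banach[OF has_sum_imp_summable[OF tS]]) auto
    have "infsum ?t (T \<union> (S - T)) = infsum ?t T + infsum ?t (S - T)"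
      using T(1) st by (intro infsum_Un_disjoint) auto
    moreover have "T \<union> (S - T) = S" using T(3) by auto
    ultimately have "r s = infsum ?t (S - T)"
      using T(1) infsumI[OF tS] by (simp add: r_def)
    then have rs: "(?t has_sum r s) (S - T)"
      using st by simp
    have nt: "norm (?t l) = (norm (b l) * exp (- (l * \<sigma>))) * exp (\<mu> * \<sigma>)" for l
      by (simp add: norm_mult s exp_add[symmetric] algebra_simps)
    have "((\<lambda>l. norm (?t l)) has_sum
        infsum (\<lambda>l. norm (b l) * exp (- (l * \<sigma>))) (S - T) * exp (\<mu> * \<sigma>)) (S - T)"
      unfolding nt by (intro has_sum_cmult_left has_sum_infsum summable_on_subset_banach[OF summable]) auto
    from norm_has_sum_bound[OF this rs]
    have "norm (r s) \<le> infsum (\<lambda>l. norm (b l) * exp (- (l * \<sigma>))) (S - T) * exp (\<mu> * \<sigma>)" .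
    also have "\<dots> \<le> (\<eta> / 2 * exp (- (\<mu> * \<sigma>))) * exp (\<mu> * \<sigma>)"
      using tail by (intro mult_right_mono) auto
    also have "\<dots> = \<eta> / 2"
      by (simp add: exp_minus)
    finally show ?thesis .
  qed
  define K where "K = (\<Sum>l\<in>T - {\<mu>}. norm (b l) * exp ((\<mu> - l) * \<sigma>) / \<bar>\<mu> - l\<bar>)"
  have Ebound: "norm (E s) \<le> K" if "Re s = \<sigma>" for s
    unfolding E_def K_def
    by (rule sum_norm_le) (use that in \<open>simp add: norm_mult norm_divide del: of_real_diff\<close>)
  define B where "B = M * exp (\<mu> * \<sigma>) * (\<sigma> - \<rho>)"
  have main: "2 * t * norm (b \<mu>) \<le> 2 * t * (M * exp (\<mu> * \<rho>)) + 2 * t * (\<eta> / 2) + 2 * (B + K)" if t: "0 < t" for t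
  proof -
    \<comment> \<open>Endpoints, at heights \<open>t\<close> and \<open>- t\<close>, of the segments
      on the lines \<open>Re s = \<sigma>\<close> and \<open>Re s = \<rho>\<close>.\<close>
    define z1 z2 y1 y2 where "z1 = Complex \<sigma> t" "z2 = Complex \<sigma> (- t)" "y1 = Complex \<rho> t" "y2 = Complex \<rho> (- t)"
    note z = z1_z2_y1_y2_def
    have vert: "norm (z1 - z2) = 2 * t" "norm (y1 - y2) = 2 * t"
      using t by (simp_all add: z cmod_def real_sqrt_mult)
    have horiz: "norm (z1 - y1) = \<sigma> - \<rho>" "norm (z2 - y2) = \<sigma> - \<rho>"
      using a by (simp_all add: z cmod_def)
    have "norm (Q z1 - Q z2) \<le> \<eta> / 2 * norm (z1 - z2)"
      by (rule field_differentiable_bound[OF cnv[of \<sigma>] dQ rbound]) (use a in \<open>auto simp: z\<close>)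
    then have q: "norm (Q z1 - Q z2) \<le> 2 * t * (\<eta> / 2)"
      by (simp add: vert mult_ac)
    have "norm (P y1 - P y2) \<le> (M * exp (\<mu> * \<rho>)) * norm (y1 - y2)"
      by (rule field_differentiable_bound[OF cnv[of \<rho>] dP]) (use a Fbound in \<open>auto simp: z\<close>)
    then have p: "norm (P y1 - P y2) \<le> 2 * t * (M * exp (\<mu> * \<rho>))"
      by (simp add: vert mult_ac)
    have strip: "convex {s. \<rho> \<le> Re s \<and> Re s \<le> \<sigma>}"
      using convex_Int[OF convex_halfspace_Re_ge[of \<rho>] convex_halfspace_Re_le[of \<sigma>]] by (simp add: Int_def)
    have Fstrip: "norm (F s) \<le> M * exp (\<mu> * \<sigma>)" if "s \<in> {s. \<rho> \<le> Re s \<and> Re s \<le> \<sigma>}" for s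
    proof -
      have "M * exp (\<mu> * Re s) \<le> M * exp (\<mu> * \<sigma>)"
        using that M0 \<mu> by (auto intro!: mult_left_mono)
      then show ?thesis using Fbound[of s] that by auto
    qed
    have "norm (P z1 - P y1) \<le> M * exp (\<mu> * \<sigma>) * norm (z1 - y1)"
      by (rule field_differentiable_bound[OF strip dP Fstrip]) (use a in \<open>auto simp: z\<close>)
    then have p1: "norm (P z1 - P y1) \<le> B" by (simp add: horiz B_def)
    have "norm (P z2 - P y2) \<le> M * exp (\<mu> * \<sigma>) * norm (z2 - y2)"
      by (rule field_differentiable_bound[OF strip dP Fstrip]) (use a in \<open>auto simp: z\<close>)
    then have p2: "norm (P z2 - P y2) \<le> B" by (simp add: horiz B_def)
    have e: "norm (E z1) \<le> K" "norm (E z2) \<le> K"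
      by (auto intro!: Ebound simp: z)
    \<comment> \<open>The increment of \<open>b \<mu> * s\<close> along the right segment is that of
      \<open>P\<close> minus those of \<open>Q\<close> and \<open>E\<close>. The increment of
      \<open>P\<close> is rerouted through the left segment, where the better bound holds.\<close>
    have id: "b \<mu> * (z1 - z2) =
        (P y1 - P y2) + (P z1 - P y1) - (P z2 - P y2) - (Q z1 - Q z2) - E z1 + E z2"
      by (simp add: Q_def algebra_simps)
    have "norm (b \<mu>) * (2 * t) = norm (b \<mu> * (z1 - z2))"
      by (simp add: norm_mult vert)
    also have "\<dots> \<le> norm (P y1 - P y2) + norm (P z1 - P y1) + norm (P z2 - P y2) + norm (Q z1 - Q z2)
        + norm (E z1) + norm (E z2)"
      unfolding id by (intro norm_triangle_le norm_triangle_le_diff add_right_mono order_refl)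
    finally show ?thesis
      using p p1 p2 q e by (simp add: mult_ac)
  qed
  \<comment> \<open>Large enough that the bounded part \<open>2 * (B + K)\<close> is at most
    \<open>t * \<eta>\<close>. With the remainder term this costs \<open>\<eta>\<close> after
    division by \<open>2 * t\<close>.\<close>
  define t where "t = 2 * (\<bar>B + K\<bar> + 1) / \<eta>"
  have t0: "0 < t" using \<eta> by (simp add: t_def add_nonneg_pos)
  have "t * \<eta> = 2 * (\<bar>B + K\<bar> + 1)"
    using \<eta> by (simp add: t_def)
  then have "2 * (B + K) \<le> t * \<eta>"
    using mult_left_mono[OF abs_ge_self[of "B + K"], of 2] by simp
  then have "2 * t * norm (b \<mu>) \<le> 2 * t * (M * exp (\<mu> * \<rho>) + \<eta>)"
    using main[OF t0] by (simp add: algebra_simps)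
  then show "norm (b \<mu>) \<le> M * exp (\<mu> * \<rho>) + \<eta>"
    using t0 by simp
qed

text \<open>By admissibility the weight at \<open>n l\<close> is eventually below
  \<open>exp (\<epsilon> * l / 2) ^ n\<close>. Half of the exponential decay is left over, and a
  geometric series dominates.\<close>

lemma admissible_weight_exp_summable:
  assumes \<omega>: "admissible_weight \<Lambda> \<omega>" and l: "l \<in> \<Lambda>" "0 < l"
    and \<Lambda>: "additive_semigroup \<Lambda>" and \<epsilon>: "0 < \<epsilon>"
  shows "(\<lambda>k::nat. \<omega> (real k * l) * exp (- (\<epsilon> * (real k * l)))) summable_on UNIV"
proof -
  have kl: "real k * l \<in> \<Lambda>" for k
    by (induction k) (use \<Lambda> l in \<open>auto simp: additive_semigroup_def algebra_simps\<close>)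
  have pos: "1 \<le> \<omega> (real k * l)" for k
    using \<omega> kl by (auto simp: admissible_weight_def weight_def)
  have gt1: "1 < exp (\<epsilon> * l / 2)"
    using \<epsilon> l by simp
  have "(\<lambda>n. \<omega> (real n * l) powr (1 / real n)) \<longlonglongrightarrow> 1"
    using \<omega> l by (auto simp: admissible_weight_def)
  then have "\<forall>\<^sub>F n in sequentially. \<omega> (real n * l) powr (1 / real n) < exp (\<epsilon> * l / 2)"
    using gt1 by (rule order_tendstoD)
  then have ev: "\<forall>\<^sub>F n in sequentially. norm (\<omega> (real n * l) * exp (- (\<epsilon> * (real n * l)))) \<le> exp (- (\<epsilon> * l / 2)) ^ n"
    using eventually_gt_at_top[of 0]
  proof eventually_elim
    case (elim n)
    have "\<omega> (real n * l) = (\<omega> (real n * l) powr (1 / real n)) powr real n"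
      using elim(2) pos[of n] by (simp add: powr_powr)
    also have "\<dots> \<le> exp (\<epsilon> * l / 2) powr real n"
      using elim by (intro powr_mono2) auto
    also have "\<dots> = exp (\<epsilon> * l / 2 * real n)"
      by (simp add: powr_def)
    finally have "\<omega> (real n * l) * exp (- (\<epsilon> * (real n * l))) \<le>
        exp (\<epsilon> * l / 2 * real n) * exp (- (\<epsilon> * (real n * l)))"
      by (intro mult_right_mono) auto
    also have "\<dots> = exp (- (\<epsilon> * l / 2)) ^ n"
      by (simp add: exp_of_nat_mult[symmetric] exp_add[symmetric] field_simps)
    finally show ?case using pos[of n] by (simp add: abs_mult)
  qed
  have "summable (\<lambda>n. exp (- (\<epsilon> * l / 2)) ^ n)"
    using \<epsilon> l by (intro summable_geometric) simp
  with ev have "summable (\<lambda>n. \<omega> (real n * l) * exp (- (\<epsilon> * (real n * l))))"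
    by (rule summable_comparison_test_ev)
  then show ?thesis
    by (rule summable_nonneg_imp_summable_on) (use pos order_trans[OF zero_le_one] in \<open>auto intro!: mult_nonneg_nonneg\<close>)
qed

text \<open>Induction on the generators. Adjoining \<open>l\<close> gives the elements
  \<open>k l + m\<close> with \<open>m\<close> in the old semigroup, and submultiplicativity
  dominates the new series by the product of the series over the multiples of \<open>l\<close> and
  the series over the old semigroup.\<close>

lemma finite_subset_exp_summable_semigroup:
  assumes \<omega>: "admissible_weight \<Lambda> \<omega>" and \<Lambda>: "additive_semigroup \<Lambda>"
    and "finite F" "F \<subseteq> \<Lambda>"
  shows "\<exists>S. additive_semigroup S \<and> F \<subseteq> S \<and> S \<subseteq> \<Lambda> \<and>
    (\<forall>\<epsilon>>0. (\<lambda>l. \<omega> l * exp (- (\<epsilon> * l))) summable_on S)"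
  using assms(3,4)
proof (induction F rule: finite_induct)
  case empty
  have "additive_semigroup {0}" "{0} \<subseteq> \<Lambda>"
    using \<Lambda> by (auto simp: additive_semigroup_def)
  then show ?case by (intro exI[of _ "{0}"]) auto
next
  case (insert l F)
  then obtain S where S: "additive_semigroup S" "F \<subseteq> S" "S \<subseteq> \<Lambda>"
    and sum: "\<And>\<epsilon>. 0 < \<epsilon> \<Longrightarrow> (\<lambda>l. \<omega> l * exp (- (\<epsilon> * l))) summable_on S"
    by auto
  have l: "l \<in> \<Lambda>" "0 \<le> l"
    using insert.prems \<Lambda> by (auto simp: additive_semigroup_def)
  show ?case
  proof (cases "l = 0")
    \<comment> \<open>The generator 0 already lies in \<open>S\<close>, and its multiples would not
      decay.\<close>
    case True
    then show ?thesis
      using S sum by (intro exI[of _ S]) (auto simp: additive_semigroup_def)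
  next
    case False
    with l have l0: "0 < l" by simp
    have w1: "\<And>x. x \<in> \<Lambda> \<Longrightarrow> 1 \<le> \<omega> x"
      and wadd: "\<And>x y. x \<in> \<Lambda> \<Longrightarrow> y \<in> \<Lambda> \<Longrightarrow> \<omega> (x + y) \<le> \<omega> x * \<omega> y"
      using \<omega> by (auto simp: admissible_weight_def weight_def)
    define G where "G = (\<lambda>(k::nat, m::real). real k * l + m)"
    have kl: "real k * l \<in> \<Lambda>" for k
      by (induction k) (use \<Lambda> l in \<open>auto simp: additive_semigroup_def algebra_simps\<close>)
    have "additive_semigroup (G ` (UNIV \<times> S))"
      unfolding additive_semigroup_def
    proof (intro conjI ballI)
      show "G ` (UNIV \<times> S) \<subseteq> {0..}"
        using S(1) l by (auto simp: G_def additive_semigroup_def)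
      show "0 \<in> G ` (UNIV \<times> S)"
        using S(1) by (intro image_eqI[of _ _ "(0, 0)"]) (auto simp: G_def additive_semigroup_def)
      fix x y assume "x \<in> G ` (UNIV \<times> S)" "y \<in> G ` (UNIV \<times> S)"
      then obtain k m k' m' where "x = real k * l + m" "m \<in> S" "y = real k' * l + m'" "m' \<in> S"
        by (auto simp: G_def)
      then show "x + y \<in> G ` (UNIV \<times> S)"
        using S(1) by (intro image_eqI[of _ _ "(k + k', m + m')"])
          (auto simp: G_def additive_semigroup_def algebra_simps)
    qed
    moreover have "insert l F \<subseteq> G ` (UNIV \<times> S)"
    proof (intro insert_subsetI subsetI)
      show "l \<in> G ` (UNIV \<times> S)"
        using S(1) by (intro image_eqI[of _ _ "(1, 0)"]) (auto simp: G_def additive_semigroup_def)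
      show "x \<in> G ` (UNIV \<times> S)" if "x \<in> F" for x
        using S(2) that by (intro image_eqI[of _ _ "(0, x)"]) (auto simp: G_def)
    qed
    moreover have "G ` (UNIV \<times> S) \<subseteq> \<Lambda>"
      using S(3) kl \<Lambda> by (auto simp: G_def additive_semigroup_def)
    moreover have "(\<lambda>x. \<omega> x * exp (- (\<epsilon> * x))) summable_on G ` (UNIV \<times> S)" if \<epsilon>: "0 < \<epsilon>" for \<epsilon>
    proof (rule summable_on_image)
      define u where "u k = \<omega> (real k * l) * exp (- (\<epsilon> * (real k * l)))" for k :: nat
      define v where "v m = \<omega> m * exp (- (\<epsilon> * m))" for m
      have uv: "0 \<le> u k" "m \<in> \<Lambda> \<Longrightarrow> 0 \<le> v m" for k m
        using w1[OF kl, of k] w1[of m] by (auto simp: u_def v_def)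
      have su: "u summable_on UNIV"
        unfolding u_def by (rule admissible_weight_exp_summable[OF \<omega> l(1) l0 \<Lambda> \<epsilon>])
      have sv: "v summable_on S"
        unfolding v_def by (rule sum[OF \<epsilon>])
      have "(\<lambda>p. u (fst p) * v (snd p)) summable_on UNIV \<times> S"
        by (rule summable_on_SigmaI[where g = "\<lambda>k. u k * infsum v S"])
           (use su sv uv S(3) in \<open>auto intro!: has_sum_cmult_right summable_on_cmult_left\<close>)
      then show "(\<lambda>p. \<omega> (G p) * exp (- (\<epsilon> * G p))) summable_on UNIV \<times> S"
      proof (rule summable_on_comparison_test)
        fix p :: "nat \<times> real" assume "p \<in> UNIV \<times> S"
        then obtain k m where p: "p = (k, m)" "m \<in> \<Lambda>"
          using S(3) by auto
        have mem: "real k * l + m \<in> \<Lambda>"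
          using \<Lambda> kl p by (auto simp: additive_semigroup_def)
        show "0 \<le> \<omega> (G p) * exp (- (\<epsilon> * G p))"
          using w1[OF mem] by (simp add: p G_def)
        have "\<omega> (real k * l + m) * exp (- (\<epsilon> * (real k * l + m))) \<le>
            (\<omega> (real k * l) * \<omega> m) * exp (- (\<epsilon> * (real k * l + m)))"
          by (intro mult_right_mono wadd kl p) auto
        also have "\<dots> = u k * v m"
          by (simp add: u_def v_def exp_add[symmetric] algebra_simps)
        finally show "\<omega> (G p) * exp (- (\<epsilon> * G p)) \<le> u (fst p) * v (snd p)"
          by (simp add: p G_def)
      qed
    qed
    ultimately show ?thesis by blast
  qed
qed

section \<open>Inverses of scalar Dirichlet series\<close>

text \<open>A shift by \<epsilon> carries \<open>- \<epsilon> \<le> Re s\<close> into the half plane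
  where \<open>m\<close> is a lower bound and changes \<open>p\<close> by at most
  \<open>K \<epsilon>\<close>, uniformly in \<open>s\<close>. Finiteness of \<open>F\<close> makes
  \<open>K \<epsilon>\<close> tend to 0.\<close>

lemma dirichlet_polynomial_lower_bound_extends:
  fixes c :: "real \<Rightarrow> complex"
  assumes F: "finite F" "F \<subseteq> {0..}" and m: "m' < m"
    and p: "p = (\<lambda>s. \<Sum>l\<in>F. c l * exp (- (of_real l * s)))"
    and lower: "\<And>s. 0 \<le> Re s \<Longrightarrow> m \<le> norm (p s)"
  shows "\<exists>\<epsilon>>0. \<forall>s. - \<epsilon> \<le> Re s \<longrightarrow> m' \<le> norm (p s)"
proof -
  define K where "K \<epsilon> = (\<Sum>l\<in>F. norm (c l) * (exp (l * \<epsilon>) - 1))" for \<epsilon>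
  have "(K \<longlongrightarrow> (\<Sum>l\<in>F. norm (c l) * (exp (l * 0) - 1))) (at_right 0)"
    unfolding K_def by (intro tendsto_intros)
  then have "\<forall>\<^sub>F \<epsilon> in at_right 0. K \<epsilon> < m - m'"
    using m by (intro order_tendstoD(2)) auto
  then have "\<forall>\<^sub>F \<epsilon> in at_right 0. K \<epsilon> < m - m' \<and> 0 < \<epsilon>"
    using eventually_at_right_less by (rule eventually_conj)
  then obtain \<epsilon> where K: "K \<epsilon> < m - m'" and \<epsilon>: "0 < \<epsilon>"
    using eventually_happens[of _ "at_right (0::real)"] by (auto simp: trivial_limit_at_right_real)
  have "m' \<le> norm (p s)" if s: "- \<epsilon> \<le> Re s" for s
  proof -
    have "norm (p (s + of_real \<epsilon>) - p s) \<le> K \<epsilon>"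
      unfolding p K_def sum_subtractf[symmetric]
    proof (rule sum_norm_le)
      fix l assume "l \<in> F"
      then have l: "0 \<le> l" using F by auto
      have "c l * exp (- (of_real l * (s + of_real \<epsilon>))) - c l * exp (- (of_real l * s)) =
          c l * exp (- (of_real l * s)) * of_real (exp (- (l * \<epsilon>)) - 1)"
        by (simp add: algebra_simps exp_add[symmetric] exp_of_real[symmetric] flip: exp_minus)
      then have "norm (c l * exp (- (of_real l * (s + of_real \<epsilon>))) - c l * exp (- (of_real l * s))) =
          norm (c l) * (exp (- (l * Re s)) * \<bar>exp (- (l * \<epsilon>)) - 1\<bar>)"
        by (simp only: norm_mult norm_of_real) simp
      also have "\<dots> \<le> norm (c l) * (exp (l * \<epsilon>) * (1 - exp (- (l * \<epsilon>))))"
      proof (intro mult_left_mono mult_mono)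
        have "l * (- \<epsilon>) \<le> l * Re s" by (rule mult_left_mono[OF s l])
        then show "exp (- (l * Re s)) \<le> exp (l * \<epsilon>)" by simp
        show "\<bar>exp (- (l * \<epsilon>)) - 1\<bar> \<le> 1 - exp (- (l * \<epsilon>))"
          using l \<epsilon> by simp
      qed auto
      also have "\<dots> = norm (c l) * (exp (l * \<epsilon>) - 1)"
        by (simp add: algebra_simps exp_minus)
      finally show "norm (c l * exp (- (of_real l * (s + of_real \<epsilon>))) - c l * exp (- (of_real l * s)))
          \<le> norm (c l) * (exp (l * \<epsilon>) - 1)" .
    qed
    moreover have "m \<le> norm (p (s + of_real \<epsilon>))"
      using s by (intro lower) simp
    moreover have "norm (p (s + of_real \<epsilon>)) \<le> norm (p (s + of_real \<epsilon>) - p s) + norm (p s)"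
      by (metis diff_add_cancel norm_triangle_ineq)
    ultimately show ?thesis using K by linarith
  qed
  with \<epsilon> show ?thesis by blast
qed

text \<open>Along the positive real axis \<open>p\<close> tends to its constant term, which
  therefore has norm at least \<open>m\<close>. Far to the right this term dominates the others, and
  a geometric series inverts \<open>p\<close> with exponents in \<open>S\<close>.\<close>

lemma dirichlet_polynomial_inverse_far_right:
  fixes c :: "real \<Rightarrow> complex"
  assumes F: "finite F" "F \<subseteq> S" and S: "additive_semigroup S" and m: "0 < m"
    and p: "p = (\<lambda>s. \<Sum>l\<in>F. c l * exp (- (of_real l * s)))"
    and lower: "\<And>s. 0 \<le> Re s \<Longrightarrow> m \<le> norm (p s)"
  shows "\<exists>\<sigma> N. 0 \<le> \<sigma> \<and> dirichlet_bounded S (\<lambda>l. exp (- (l * \<sigma>))) \<sigma> N (\<lambda>s. inverse (p s))"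
proof -
  \<comment> \<open>The default 0 covers a sum without constant term; the lower bound on
    \<open>p\<close> then excludes this case.\<close>
  define c0 where "c0 = (if 0 \<in> F then c 0 else 0)"
  define F' where "F' = F - {0}"
  have F': "finite F'" "F' \<subseteq> S" "\<And>l. l \<in> F' \<Longrightarrow> 0 < l"
    using F S by (auto simp: F'_def additive_semigroup_def)
  have p_split: "p s = c0 + (\<Sum>l\<in>F'. c l * exp (- (of_real l * s)))" for s
    using F(1) by (cases "0 \<in> F") (simp_all add: p c0_def F'_def sum.remove)
  define R where "R \<sigma> = (\<Sum>l\<in>F'. norm (c l) * exp (- (l * \<sigma>)))" for \<sigma>
  have "((\<lambda>\<sigma>. exp (- (l * \<sigma>))) \<longlongrightarrow> 0) at_top" if "0 < l" for l :: real
    using that by real_asymp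
  then have R0: "(R \<longlongrightarrow> 0) at_top"
    unfolding R_def by (auto intro!: tendsto_null_sum tendsto_mult_right_zero F')
  have "norm (p (of_real \<sigma>)) \<le> norm c0 + R \<sigma>" for \<sigma>
    unfolding p_split R_def
    by (intro norm_triangle_mono order_refl sum_norm_le) (simp add: norm_mult)
  then have R_ge: "m \<le> norm c0 + R \<sigma>" if "0 \<le> \<sigma>" for \<sigma>
    using lower[of "of_real \<sigma>"] that by (metis Re_complex_of_real order_trans)
  have "((\<lambda>\<sigma>. norm c0 + R \<sigma>) \<longlongrightarrow> norm c0 + 0) at_top"
    by (intro tendsto_intros R0)
  moreover have "\<forall>\<^sub>F \<sigma> in at_top. m \<le> norm c0 + R \<sigma>"
    using eventually_ge_at_top[of "0::real"] by eventually_elim (rule R_ge)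
  ultimately have "m \<le> norm c0 + 0"
    by (rule tendsto_lowerbound) simp
  with m have c0: "0 < norm c0" by linarith
  have "\<forall>\<^sub>F \<sigma> in at_top. R \<sigma> < norm c0 / 2"
    using R0 c0 by (intro order_tendstoD(2)) auto
  then have "\<forall>\<^sub>F \<sigma> in at_top. R \<sigma> < norm c0 / 2 \<and> 0 \<le> \<sigma>"
    using eventually_ge_at_top[of "0::real"] by (rule eventually_conj)
  then obtain \<sigma> where R: "R \<sigma> < norm c0 / 2" and \<sigma>: "0 \<le> \<sigma>"
    by (metis (mono_tags, lifting) eventually_at_top_linorder order_refl)
  interpret dirichlet_weight S "\<lambda>l. exp (- (l * \<sigma>))" \<sigma>
    by unfold_locales (use S in \<open>auto simp: exp_add[symmetric] algebra_simps\<close>)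
  \<comment> \<open>Normalised so that \<open>p s = c0 * (1 - r s)\<close>.\<close>
  define r where "r s = (\<Sum>l\<in>F'. - c l / c0 * exp (- (of_real l * s)))" for s
  have r_eq: "p s = c0 * (1 - r s)" for s
    using c0 by (simp add: p_split r_def algebra_simps sum_distrib_left sum_negf)
  have half: "dirichlet_bounded S (\<lambda>l. exp (- (l * \<sigma>))) \<sigma> (1 / 2) r"
  proof (rule dirichlet_bounded_family[where I = F' and r = "\<lambda>l. l" and c = "\<lambda>l. - c l / c0"])
    show "((\<lambda>l. norm (- c l / c0) * exp (- (l * \<sigma>))) has_sum R \<sigma> / norm c0) F'"
      by (rule has_sum_finiteI) (simp_all add: F' R_def norm_divide sum_divide_distrib)
    show "R \<sigma> / norm c0 \<le> 1 / 2"
      using R c0 by (simp add: field_simps)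
  qed (use F' nonneg in \<open>auto simp: r_def\<close>)
  have "dirichlet_bounded S (\<lambda>l. exp (- (l * \<sigma>))) \<sigma> 2 (\<lambda>s. \<Sum>n. r s ^ n)"
    using dirichlet_bounded_suminf[OF dirichlet_bounded_power[OF half] geometric_sums[of "1 / 2 :: real"]] by simp
  from dirichlet_bounded_mult[OF dirichlet_bounded_const[of "inverse c0"] this]
  have "dirichlet_bounded S (\<lambda>l. exp (- (l * \<sigma>))) \<sigma> (norm (inverse c0) * 2) (\<lambda>s. inverse c0 * (\<Sum>n. r s ^ n))" .
  then have "dirichlet_bounded S (\<lambda>l. exp (- (l * \<sigma>))) \<sigma> (norm (inverse c0) * 2) (\<lambda>s. inverse (p s))"
  proof (rule dirichlet_bounded_cong)
    fix s :: complex assume "\<sigma> \<le> Re s"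
    then have "norm (r s) < 1"
      using dirichlet_bounded_norm_le[OF half] by (smt (verit) field_sum_of_halves)
    then show "inverse c0 * (\<Sum>n. r s ^ n) = inverse (p s)"
      by (simp add: suminf_geometric r_eq inverse_eq_divide)
  qed
  with \<sigma> show ?thesis by blast
qed

text \<open>The point is that \<open>C\<close> does not depend on \<open>n\<close>: it is a weighted
  exponential sum over a semigroup containing \<open>F\<close>. The power \<open>n\<close> enters
  only through the bound \<open>(1 / m') ^ n\<close> for the function itself.\<close>

lemma dirichlet_polynomial_inverse_power:
  fixes c :: "real \<Rightarrow> complex"
  assumes \<Lambda>: "additive_semigroup \<Lambda>" and \<omega>: "admissible_weight \<Lambda> \<omega>"
    and F: "finite F" "F \<subseteq> \<Lambda>" and m: "0 < m'" "m' < m"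
    and p: "p = (\<lambda>s. \<Sum>l\<in>F. c l * exp (- (of_real l * s)))"
    and lower: "\<And>s. 0 \<le> Re s \<Longrightarrow> m \<le> norm (p s)"
  shows "\<exists>C. \<forall>n. dirichlet_bounded \<Lambda> \<omega> 0 (C * (1 / m') ^ n) (\<lambda>s. inverse (p s) ^ n)"
proof -
  have \<omega>1: "\<And>l. l \<in> \<Lambda> \<Longrightarrow> 1 \<le> \<omega> l"
    using \<omega> by (auto simp: admissible_weight_def weight_def)
  have \<Lambda>0: "\<Lambda> \<subseteq> {0..}"
    using \<Lambda> by (simp add: additive_semigroup_def)
  obtain e where e: "0 < e" and lower_e: "\<And>s. - e \<le> Re s \<Longrightarrow> m' \<le> norm (p s)"
    using dirichlet_polynomial_lower_bound_extends[OF F(1) _ m(2) p lower] F(2) \<Lambda>0 by blast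
  \<comment> \<open>Smaller than \<open>e\<close>, so that the line
    \<open>Re s = - \<epsilon>\<close> lies inside the open half plane where the inverse is
    holomorphic.\<close>
  define \<epsilon> where "\<epsilon> = e / 2"
  have \<epsilon>: "0 < \<epsilon>" "- e < - \<epsilon>" using e by (auto simp: \<epsilon>_def)
  obtain S where S: "additive_semigroup S" "F \<subseteq> S" "S \<subseteq> \<Lambda>"
    and sumS: "\<And>\<epsilon>. 0 < \<epsilon> \<Longrightarrow> (\<lambda>l. \<omega> l * exp (- (\<epsilon> * l))) summable_on S"
    using finite_subset_exp_summable_semigroup[OF \<omega> \<Lambda> F] by blast
  obtain \<sigma> N where \<sigma>: "0 \<le> \<sigma>"
    and inv: "dirichlet_bounded S (\<lambda>l. exp (- (l * \<sigma>))) \<sigma> N (\<lambda>s. inverse (p s))"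
    using dirichlet_polynomial_inverse_far_right[OF F(1) S(2,1) _ p lower] m by auto
  interpret dirichlet_weight S "\<lambda>l. exp (- (l * \<sigma>))" \<sigma>
    by unfold_locales (use S in \<open>auto simp: exp_add[symmetric] algebra_simps\<close>)
  define C where "C = (\<Sum>\<^sub>\<infinity>l\<in>S. \<omega> l * exp (- (\<epsilon> * l)))"
  have "dirichlet_bounded \<Lambda> \<omega> 0 (C * (1 / m') ^ n) (\<lambda>s. inverse (p s) ^ n)" for n
  proof -
    define h where "h s = inverse (p s) ^ n" for s
    obtain b M where bsum: "((\<lambda>l. norm (b l) * exp (- (l * \<sigma>))) has_sum M) S"
      and b: "\<And>s. \<sigma> \<le> Re s \<Longrightarrow> ((\<lambda>l. b l * exp (- (of_real l * s))) has_sum h s) S"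
      using dirichlet_bounded_power[OF inv, of n] unfolding dirichlet_bounded_def h_def by blast
    have p0: "p s \<noteq> 0" if "- e \<le> Re s" for s
      using lower_e[OF that] m(1) by auto
    have hol: "h holomorphic_on {s. - e < Re s}"
      unfolding h_def using p0 by (auto intro!: holomorphic_intros simp: p)
    have bound: "norm (h s) \<le> (1 / m') ^ n" if "- \<epsilon> \<le> Re s" for s
    proof -
      have "inverse (norm (p s)) \<le> inverse m'"
        using lower_e[of s] that \<epsilon>(2) m(1) by (intro le_imp_inverse_le) auto
      then show ?thesis
        unfolding h_def norm_power norm_inverse divide_inverse mult_1 by (rule power_mono) simp
    qed
    have coeff: "norm (b l) \<le> (1 / m') ^ n * exp (- (\<epsilon> * l))" if "l \<in> S" for l
    proof -
      \<comment> \<open>The coefficient estimate with \<open>\<rho> = - \<epsilon>\<close>: a line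
        to the left of the imaginary axis produces decay in \<open>l\<close>.\<close>
      have "norm (b l) \<le> (1 / m') ^ n * exp (l * - \<epsilon>)"
        by (rule dirichlet_coefficient_bound[OF hol \<epsilon>(2) _ bound has_sum_imp_summable[OF bsum] b])
           (use that nonneg \<epsilon> \<sigma> in auto)
      then show ?thesis by (simp add: mult.commute)
    qed
    have coeff_\<omega>: "norm (b l) * \<omega> l \<le> (1 / m') ^ n * (\<omega> l * exp (- (\<epsilon> * l)))" if "l \<in> S" for l
      using mult_right_mono[OF coeff[OF that], of "\<omega> l"] \<omega>1[of l] S(3) that by (auto simp: mult_ac)
    have major: "((\<lambda>l. (1 / m') ^ n * (\<omega> l * exp (- (\<epsilon> * l)))) has_sum (1 / m') ^ n * C) S"
      unfolding C_def by (intro has_sum_cmult_right has_sum_infsum sumS \<epsilon>(1))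
    have b\<omega>: "(\<lambda>l. norm (b l) * \<omega> l) summable_on S"
      by (rule summable_on_comparison_test[OF has_sum_imp_summable[OF major] coeff_\<omega>])
         (use \<omega>1 S(3) in \<open>force intro!: mult_nonneg_nonneg\<close>)+
    \<comment> \<open>The expansion of \<open>h\<close> is known only for
      \<open>\<sigma> \<le> Re s\<close>. The same series is now summed further to the left and
      identified with \<open>h\<close> there by analytic continuation.\<close>
    define g where "g s = (\<Sum>\<^sub>\<infinity>l\<in>S. b l * exp (- (of_real l * s)))" for s
    \<comment> \<open>Half of the decay \<open>exp (- (\<epsilon> * l))\<close> absorbs the growth
      of the exponentials on \<open>D\<close>; the other half leaves a summable majorant.
      \<open>D\<close> contains the closed right half plane.\<close>
    define D where "D = {s. - (\<epsilon> / 2) < Re s}"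
    have D: "open D" "connected D"
      unfolding D_def using open_halfspace_Re_gt[of "- (\<epsilon> / 2)"] convex_halfspace_Re_gt[of "- (\<epsilon> / 2)"]
      by (auto intro: convex_connected)
    have g_hol: "g holomorphic_on D"
    proof -
      have "\<exists>r>0. g holomorphic_on ball z r" if z: "z \<in> D" for z
      proof -
        obtain r where r: "0 < r" "cball z r \<subseteq> D"
          using D(1) z open_contains_cball by blast
        have le: "norm (b l * exp (- (of_real l * s))) \<le> (1 / m') ^ n * (\<omega> l * exp (- (\<epsilon> / 2 * l)))"
          if l: "l \<in> S" and s: "s \<in> cball z r" for l s
        proof -
          have "- (\<epsilon> / 2) \<le> Re s" "0 \<le> l" using r s l nonneg by (auto simp: D_def)
          then have "l * - (\<epsilon> / 2) \<le> l * Re s" by (rule mult_left_mono)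
          then have "norm (b l * exp (- (of_real l * s))) \<le> norm (b l) * exp (\<epsilon> / 2 * l)"
            by (simp add: norm_mult mult_left_mono mult.commute)
          also have "\<dots> \<le> (1 / m') ^ n * exp (- (\<epsilon> * l)) * exp (\<epsilon> / 2 * l)"
            by (rule mult_right_mono[OF coeff[OF l]]) simp
          also have "\<dots> = (1 / m') ^ n * (1 * exp (- (\<epsilon> / 2 * l)))"
            by (simp add: exp_add[symmetric] mult.assoc field_simps)
          also have "\<dots> \<le> (1 / m') ^ n * (\<omega> l * exp (- (\<epsilon> / 2 * l)))"
            using \<omega>1[of l] l S(3) m(1) by (intro mult_left_mono mult_right_mono) auto
          finally show ?thesis .
        qed
        have ul: "uniform_limit (cball z r) (\<lambda>X s. \<Sum>l\<in>X. b l * exp (- (of_real l * s))) g (finite_subsets_at_top S)"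
          unfolding g_def
          by (rule Weierstrass_m_test_general[OF le]) (use sumS[of "\<epsilon> / 2"] \<epsilon> in \<open>auto intro!: summable_on_cmult_right\<close>)
        have "continuous_on (cball z r) (\<lambda>s. \<Sum>l\<in>X. b l * exp (- (of_real l * s))) \<and>
            (\<lambda>s. \<Sum>l\<in>X. b l * exp (- (of_real l * s))) holomorphic_on ball z r" for X
          by (intro conjI continuous_intros holomorphic_intros)
        then have "g holomorphic_on ball z r"
          using holomorphic_uniform_limit[OF always_eventually ul] by auto
        with r(1) show ?thesis by blast
      qed
      then show ?thesis
        by (metis D(1) analytic_on_def analytic_on_open)
    qed
    \<comment> \<open>Both functions are holomorphic on the connected set \<open>D\<close> and agree
      on the open half plane \<open>\<sigma> < Re s\<close>.\<close>
    have gh: "g s = h s" if s: "s \<in> D" for s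
    proof (rule analytic_continuation_open[of "{s. \<sigma> < Re s}" D g h s])
      show "open {s. \<sigma> < Re s}"
        using open_halfspace_Re_gt[of \<sigma>] by simp
      have "of_real (\<sigma> + 1) \<in> {s. \<sigma> < Re s}" by simp
      then show "{s. \<sigma> < Re s} \<noteq> {}" by blast
      show "h holomorphic_on D"
        by (rule holomorphic_on_subset[OF hol]) (use e in \<open>auto simp: D_def \<epsilon>_def\<close>)
      show "g z = h z" if "z \<in> {s. \<sigma> < Re s}" for z
        unfolding g_def using b[of z] that by (auto intro: infsumI)
    qed (use D g_hol \<sigma> \<epsilon> s in \<open>auto simp: D_def\<close>)
    show ?thesis
    proof (rule dirichlet_bounded_family[where I = S and r = "\<lambda>l. l" and c = b])
      show "((\<lambda>l. norm (b l) * \<omega> l) has_sum (\<Sum>\<^sub>\<infinity>l\<in>S. norm (b l) * \<omega> l)) S"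
        by (rule has_sum_infsum[OF b\<omega>])
      show "(\<Sum>\<^sub>\<infinity>l\<in>S. norm (b l) * \<omega> l) \<le> C * (1 / m') ^ n"
        using has_sum_mono[OF has_sum_infsum[OF b\<omega>] major coeff_\<omega>] by (simp add: mult.commute)
      fix s :: complex assume "0 \<le> Re s"
      then have "s \<in> D" using \<epsilon> by (simp add: D_def)
      from gh[OF this] show "inverse (p s) ^ n = (\<Sum>\<^sub>\<infinity>l\<in>S. b l * exp (- (of_real l * s)))"
        by (simp add: g_def h_def)
    qed (use S \<Lambda>0 \<omega>1 in auto)
  qed
  then show ?thesis by blast
qed

lemma admissible_dirichlet_weight:
  assumes "additive_semigroup \<Lambda>" "admissible_weight \<Lambda> \<omega>"
  shows "dirichlet_weight \<Lambda> \<omega> 0"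
  using assms by unfold_locales (auto simp: admissible_weight_def weight_def)

text \<open>Choice of constants: \<open>q\<close> has weighted norm at most
  \<open>\<delta> / 4\<close>, so \<open>p\<close> is bounded below by
  \<open>3 * \<delta> / 4\<close>. The smaller bound \<open>\<delta> / 2\<close> then controls the
  inverse powers of \<open>p\<close>, and the terms of the series have norms in the ratio
  \<open>(\<delta> / 4) * (2 / \<delta>) = 1 / 2\<close>.\<close>

theorem dirichlet_bounded_inverse:
  assumes \<Lambda>: "additive_semigroup \<Lambda>" and \<omega>: "admissible_weight \<Lambda> \<omega>"
    and f: "dirichlet_bounded \<Lambda> \<omega> 0 N f" and \<delta>: "0 < \<delta>"
    and lower: "\<And>s. 0 \<le> Re s \<Longrightarrow> \<delta> \<le> norm (f s)"
  shows "\<exists>N'. dirichlet_bounded \<Lambda> \<omega> 0 N' (\<lambda>s. inverse (f s))"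
proof -
  interpret dirichlet_weight \<Lambda> \<omega> 0
    by (rule admissible_dirichlet_weight[OF \<Lambda> \<omega>])
  obtain c M where M: "((\<lambda>l. norm (c l) * \<omega> l) has_sum M) \<Lambda>"
    and c: "\<And>s. 0 \<le> Re s \<Longrightarrow> ((\<lambda>l. c l * exp (- (of_real l * s))) has_sum f s) \<Lambda>"
    using f unfolding dirichlet_bounded_def by blast
  obtain F where F: "finite F" "F \<subseteq> \<Lambda>"
    and tail: "infsum (\<lambda>l. norm (c l) * \<omega> l) (\<Lambda> - F) < \<delta> / 4"
    by (rule infsum_tail_small[OF has_sum_imp_summable[OF M], of "{}" "\<delta> / 4"]) (use \<delta> in auto)
  define p where "p = (\<lambda>s. \<Sum>l\<in>F. c l * exp (- (of_real l * s)))"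
  define q where "q s = p s - f s" for s
  have q: "dirichlet_bounded \<Lambda> \<omega> 0 (\<delta> / 4) q"
  proof (rule dirichlet_bounded_family[where I = "\<Lambda> - F" and r = "\<lambda>l. l" and c = "\<lambda>l. - c l"])
    show "((\<lambda>l. norm (- c l) * \<omega> l) has_sum infsum (\<lambda>l. norm (c l) * \<omega> l) (\<Lambda> - F)) (\<Lambda> - F)"
      using summable_on_subset_banach[OF has_sum_imp_summable[OF M], of "\<Lambda> - F"] by simp
    fix s :: complex assume s: "0 \<le> Re s"
    let ?t = "\<lambda>l. c l * exp (- (of_real l * s))"
    have st: "?t summable_on (\<Lambda> - F)"
      by (rule summable_on_subset_banach[OF has_sum_imp_summable[OF c[OF s]]]) auto
    have "infsum ?t (F \<union> (\<Lambda> - F)) = infsum ?t F + infsum ?t (\<Lambda> - F)"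
      using F(1) st by (intro infsum_Un_disjoint) auto
    moreover have "F \<union> (\<Lambda> - F) = \<Lambda>" using F(2) by auto
    ultimately show "q s = (\<Sum>\<^sub>\<infinity>l\<in>\<Lambda> - F. - c l * exp (- (of_real l * s)))"
      using F(1) infsumI[OF c[OF s]] by (simp add: q_def p_def infsum_uminus)
  qed (use tail nonneg weight_ge in auto)
  have q_le: "norm (q s) \<le> \<delta> / 4" if "0 \<le> Re s" for s
    by (rule dirichlet_bounded_norm_le[OF q that])
  have p_ge: "3 * \<delta> / 4 \<le> norm (p s)" if "0 \<le> Re s" for s
  proof -
    have "norm (f s) \<le> norm (p s) + norm (q s)"
      unfolding q_def by (metis diff_diff_eq2 add_diff_cancel_left' norm_triangle_ineq4)
    then show ?thesis using q_le[OF that] lower[OF that] by linarith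
  qed
  obtain C where C: "\<And>n. dirichlet_bounded \<Lambda> \<omega> 0 (C * (1 / (\<delta> / 2)) ^ n) (\<lambda>s. inverse (p s) ^ n)"
    using dirichlet_polynomial_inverse_power[OF \<Lambda> \<omega> F _ _ p_def p_ge, of "\<delta> / 2"] \<delta> by auto
  have summand: "dirichlet_bounded \<Lambda> \<omega> 0 ((C * (2 / \<delta>)) * (1 / 2) ^ n) (\<lambda>s. q s ^ n * inverse (p s) ^ Suc n)" for n
  proof -
    have "(\<delta> / 4) ^ n * (C * (1 / (\<delta> / 2)) ^ Suc n) = (C * (2 / \<delta>)) * ((\<delta> / 4) * (2 / \<delta>)) ^ n"
      by (simp only: divide_divide_eq_right mult_1 power_Suc power_mult_distrib mult_ac)
    also have "(\<delta> / 4) * (2 / \<delta>) = 1 / 2" using \<delta> by simp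
    finally show ?thesis
      using dirichlet_bounded_mult[OF dirichlet_bounded_power[OF q] C[of "Suc n"], of n] by (simp only:)
  qed
  have "(\<lambda>n. (C * (2 / \<delta>)) * (1 / 2) ^ n) sums ((C * (2 / \<delta>)) * 2)"
    using geometric_sums[of "1 / 2 :: real"] by (intro sums_mult) simp
  from dirichlet_bounded_suminf[OF summand this]
  have "dirichlet_bounded \<Lambda> \<omega> 0 ((C * (2 / \<delta>)) * 2) (\<lambda>s. inverse (f s))"
  proof (rule dirichlet_bounded_cong)
    fix s :: complex assume s: "0 \<le> Re s"
    have p0: "p s \<noteq> 0" "f s \<noteq> 0"
      using p_ge[OF s] lower[OF s] \<delta> by auto
    \<comment> \<open>With this ratio \<open>f s = p s * (1 - x)\<close>, and the series is
      geometric at each point.\<close>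
    define x where "x = q s / p s"
    have "norm (q s) < norm (p s)"
      using q_le[OF s] p_ge[OF s] \<delta> by linarith
    then have x: "norm x < 1"
      using p0 by (simp add: x_def norm_divide)
    have "q s ^ n * inverse (p s) ^ Suc n = inverse (p s) * x ^ n" for n
      by (simp add: x_def power_divide power_inverse field_simps)
    then have "(\<Sum>n. q s ^ n * inverse (p s) ^ Suc n) = (\<Sum>n. inverse (p s) * x ^ n)"
      by (simp only:)
    also have "\<dots> = inverse (p s) * (\<Sum>n. x ^ n)"
      using x by (intro suminf_mult summable_geometric)
    also have "\<dots> = inverse (p s * (1 - x))"
      using x by (simp add: suminf_geometric inverse_eq_divide)
    also have "p s * (1 - x) = f s"
      using p0 by (simp add: x_def q_def field_simps)
    finally show "(\<Sum>n. q s ^ n * inverse (p s) ^ Suc n) = inverse (f s)" .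
  qed
  then show ?thesis by blast
qed

section \<open>Complex representation of quaternionic matrices\<close>

text \<open>
  In the index type 4 the numerals 0 and 4 coincide, so \<^const>\<open>qmult\<close> reads the real part of its
  arguments at index 4 but writes the real part of the product at index 1: it is the quaternion
  product followed by a cyclic shift of the coordinates. It is not associative and \<^const>\<open>qone\<close>
  is not its unit, but \<^const>\<open>qone\<close> is the shifted unit. Undoing the shift gives the quaternion
  algebra, and all equations of the form \<open>x y = 1\<close> have the same meaning in both.
\<close>
definition qmul :: "quat \<Rightarrow> quat \<Rightarrow> quat" where
  "qmul a b = (\<chi> i. qmult a b $ (i + 1))"

lemma four_arith: "(0::4) = 4" "(5::4) = 1"
  by simp_all

lemma vector_4_nth:
  "(vector [x, y, z, w] :: 'a::zero^4) $ 1 = x"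
  "(vector [x, y, z, w] :: 'a::zero^4) $ 2 = y"
  "(vector [x, y, z, w] :: 'a::zero^4) $ 3 = z"
  "(vector [x, y, z, w] :: 'a::zero^4) $ 4 = w"
  unfolding vector_def by simp_all

lemma qmul_nth:
  "qmul a b $ 4 = a$4*b$4 - a$1*b$1 - a$2*b$2 - a$3*b$3"
  "qmul a b $ 1 = a$4*b$1 + a$1*b$4 + a$2*b$3 - a$3*b$2"
  "qmul a b $ 2 = a$4*b$2 - a$1*b$3 + a$2*b$4 + a$3*b$1"
  "qmul a b $ 3 = a$4*b$3 + a$1*b$2 - a$2*b$1 + a$3*b$4"
  by (simp_all add: qmul_def qmult_def four_arith vector_4_nth)

lemma qmult_nth: "qmult a b $ i = qmul a b $ (i - 1)"
  by (simp add: qmul_def)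

lemma qone_nth: "qone $ i = axis 4 1 $ (i - 1)"
proof -
  have "\<forall>i. qone $ i = axis 4 1 $ (i - 1)"
    by (simp add: forall_4 qone_def vector_4_nth axis_def four_arith)
  then show ?thesis by blast
qed

lemma qmul_assoc: "qmul (qmul a b) c = qmul a (qmul b c)"
  by (simp add: vec_eq_iff forall_4 qmul_nth algebra_simps)

lemma qmul_unit: "qmul a (axis 4 1) = a" "qmul (axis 4 1) a = a"
  by (simp_all add: vec_eq_iff forall_4 qmul_nth axis_def)

lemma bounded_bilinear_qmul: "bounded_bilinear qmul"
  unfolding bilinear_conv_bounded_bilinear[symmetric] bilinear_def
  by (intro conjI allI linearI) (simp_all add: vec_eq_iff forall_4 qmul_nth algebra_simps)

interpretation qmul: bounded_bilinear qmul
  by (rule bounded_bilinear_qmul)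

lemma bounded_bilinear_qmult: "bounded_bilinear qmult"
  unfolding bilinear_conv_bounded_bilinear[symmetric] bilinear_def
  by (intro conjI allI linearI)
     (simp_all add: vec_eq_iff qmult_nth qmul.add_left qmul.add_right qmul.scaleR_left qmul.scaleR_right)

interpretation qmult: bounded_bilinear qmult
  by (rule bounded_bilinear_qmult)

text \<open>The vectors \<open>qmul p (axis b 1)\<close> are the columns of the real matrix of left
  multiplication by \<open>p\<close>.\<close>

lemma qmul_expand: "(\<Sum>b\<in>UNIV. qmul p (axis b 1) $ a * v $ b) = qmul p v $ a"
proof -
  have "\<forall>a. (\<Sum>b\<in>UNIV. qmul p (axis b 1) $ a * v $ b) = qmul p v $ a"
    by (simp add: forall_4 sum_4 qmul_nth axis_def)
  then show ?thesis by blast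
qed

section \<open>Comparison of the operator norm with the coordinates\<close>

lemma bounded_linear_qmat_vec: "bounded_linear (qmat_vec A)"
  unfolding linear_conv_bounded_linear[symmetric]
  by (intro linearI)
     (simp_all add: qmat_vec_def vec_eq_iff qmult.add_right qmult.scaleR_right sum.distrib scaleR_sum_right sum_distrib_left)

lemma component_le_qmat_norm: "\<bar>A $ i $ j $ k\<bar> \<le> qmat_norm A"
proof -
  \<comment> \<open>The quaternion unit in slot \<open>j\<close> picks out the entry; the shift in
    \<open>qmult\<close> moves its coordinate \<open>k\<close> to \<open>k + 1\<close>.\<close>
  let ?v = "axis j (axis 4 1) :: 'a qvec"
  have "qmat_vec A ?v $ i = (\<Sum>j'\<in>UNIV. if j' = j then qmult (A $ i $ j') (axis 4 1) else 0)"
    unfolding qmat_vec_def vec_lambda_beta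
    by (rule sum.cong) (auto simp: axis_def[of j] qmult.zero_right)
  then have "A $ i $ j $ k = qmat_vec A ?v $ i $ (k + 1)"
    by (simp add: qmult_nth qmul_unit)
  also have "\<bar>\<dots>\<bar> \<le> norm (qmat_vec A ?v)"
    by (meson component_le_norm_cart Finite_Cartesian_Product.norm_nth_le order_trans)
  also have "\<dots> \<le> onorm (qmat_vec A) * norm ?v"
    by (rule onorm[OF bounded_linear_qmat_vec])
  finally show ?thesis
    by (simp add: qmat_norm_def)
qed

lemma norm_vec_le_sum: "norm (x :: 'a::real_normed_vector ^ 'n) \<le> (\<Sum>i\<in>UNIV. norm (x $ i))"
  unfolding norm_vec_def by (rule L2_set_le_sum) simp

lemma norm_qmat_le_sum:
  "norm (A :: 'd::finite qmat) \<le> (\<Sum>i\<in>UNIV. \<Sum>j\<in>UNIV. \<Sum>k\<in>UNIV. \<bar>A $ i $ j $ k\<bar>)"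
  by (intro order_trans[OF norm_vec_le_sum] sum_mono) simp

lemma norm_qmat_le:
  "norm (A :: 'd::finite qmat) \<le> real (CARD('d) * CARD('d) * 4) * qmat_norm A"
proof -
  have "norm A \<le> (\<Sum>i\<in>(UNIV::'d set). \<Sum>j\<in>(UNIV::'d set). \<Sum>k\<in>(UNIV::4 set). qmat_norm A)"
    by (intro order_trans[OF norm_qmat_le_sum] sum_mono component_le_qmat_norm)
  then show ?thesis by (simp add: mult_ac)
qed

lemma qmat_norm_nonneg: "0 \<le> qmat_norm A"
  unfolding qmat_norm_def by (rule onorm_pos_le[OF bounded_linear_qmat_vec])

text \<open>Together with \<open>component_le_qmat_norm\<close> this makes summability in the
  operator norm a coordinatewise matter. \<open>K\<close> is the bilinear bound of
  \<open>qmult\<close>, the same for all \<open>A\<close>.\<close>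

lemma qmat_norm_le:
  "\<exists>K\<ge>0. \<forall>A :: 'd::finite qmat.
     qmat_norm A \<le> K * (\<Sum>i\<in>UNIV. \<Sum>j\<in>UNIV. \<Sum>k\<in>UNIV. \<bar>A $ i $ j $ k\<bar>)"
proof -
  obtain K where K: "0 \<le> K" "\<And>a b. norm (qmult a b) \<le> norm a * norm b * K"
    using qmult.nonneg_bounded by blast
  have "qmat_norm A \<le> K * (\<Sum>i\<in>UNIV. \<Sum>j\<in>UNIV. \<Sum>k\<in>UNIV. \<bar>A $ i $ j $ k\<bar>)" for A :: "'d qmat"
    unfolding qmat_norm_def
  proof (rule onorm_le)
    fix v :: "'d qvec"
    have "norm (qmat_vec A v) \<le> (\<Sum>i\<in>UNIV. \<Sum>j\<in>UNIV. norm (qmult (A $ i $ j) (v $ j)))"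
      by (rule order_trans[OF norm_vec_le_sum], rule sum_mono) (simp add: qmat_vec_def norm_sum)
    also have "\<dots> \<le> (\<Sum>i\<in>UNIV. \<Sum>j\<in>UNIV. K * (\<Sum>k\<in>UNIV. \<bar>A $ i $ j $ k\<bar>) * norm v)"
    proof (intro sum_mono)
      fix i j
      have "norm (qmult (A $ i $ j) (v $ j)) \<le> norm (A $ i $ j) * norm (v $ j) * K"
        by (rule K(2))
      also have "\<dots> \<le> (\<Sum>k\<in>UNIV. \<bar>A $ i $ j $ k\<bar>) * norm v * K"
        using norm_vec_le_sum[of "A $ i $ j"] Finite_Cartesian_Product.norm_nth_le[of v j] K(1)
        by (intro mult_right_mono mult_mono) auto
      finally show "norm (qmult (A $ i $ j) (v $ j)) \<le> K * (\<Sum>k\<in>UNIV. \<bar>A $ i $ j $ k\<bar>) * norm v"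
        by (simp add: mult_ac)
    qed
    also have "\<dots> = K * (\<Sum>i\<in>UNIV. \<Sum>j\<in>UNIV. \<Sum>k\<in>UNIV. \<bar>A $ i $ j $ k\<bar>) * norm v"
      by (simp only: sum_distrib_left sum_distrib_right)
    finally show "norm (qmat_vec A v) \<le> K * (\<Sum>i\<in>UNIV. \<Sum>j\<in>UNIV. \<Sum>k\<in>UNIV. \<bar>A $ i $ j $ k\<bar>) * norm v" .
  qed
  with K(1) show ?thesis by blast
qed

section \<open>The representation by complex matrices and the determinant criterion\<close>

definition qmm :: "'d::finite qmat \<Rightarrow> 'd qmat \<Rightarrow> 'd qmat" where
  "qmm A B = (\<chi> i j. \<Sum>k\<in>UNIV. qmul (A $ i $ k) (B $ k $ j))"

definition cqmm :: "'d::finite cqmat \<Rightarrow> 'd cqmat \<Rightarrow> 'd cqmat" where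
  "cqmm X Y = (qmm (fst X) (fst Y) - qmm (snd X) (snd Y), qmm (fst X) (snd Y) + qmm (snd X) (fst Y))"

definition cqid :: "'d::finite cqmat" where
  "cqid = ((\<chi> i j. if i = j then axis 4 1 else 0), 0)"

text \<open>The coordinate shift \<open>sh\<close> is additive and injective, and componentwise it
  carries \<open>cqmm\<close> to \<open>cq_mult\<close> and \<open>cqid\<close> to
  \<open>cq_one\<close>.\<close>

lemma cq_mult_eq_cq_one_iff: "cq_mult X Y = cq_one \<longleftrightarrow> cqmm X Y = cqid"
proof -
  define sh :: "'a qmat \<Rightarrow> 'a qmat" where "sh A = (\<chi> i j k. A $ i $ j $ (k - 1))" for A
  have inj: "sh A = sh B \<longleftrightarrow> A = B" for A B
    unfolding sh_def vec_eq_iff vec_lambda_beta by (metis add_diff_cancel_right')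
  have mult: "qmat_mult A B = sh (qmm A B)" for A B :: "'a qmat"
    by (simp add: qmat_mult_def qmm_def sh_def vec_eq_iff qmult_nth)
  have add: "sh (A + B) = sh A + sh B" and diff: "sh (A - B) = sh A - sh B" for A B
    by (simp_all add: sh_def vec_eq_iff)
  have "qmat_id = sh (fst cqid)" "sh (snd cqid) = (0 :: 'a qmat)"
    by (simp_all add: sh_def qmat_id_def cqid_def vec_eq_iff qone_nth)
  then have "cq_mult X Y = cq_one \<longleftrightarrow>
      sh (fst (cqmm X Y)) = sh (fst cqid) \<and> sh (snd (cqmm X Y)) = sh (snd cqid)"
    by (simp add: cq_mult_def cq_one_def cqmm_def mult add diff)
  then show ?thesis
    unfolding inj by (simp add: prod_eq_iff)
qed

text \<open>The left regular representation of the quaternions on real 4-space, applied to each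
  matrix entry and complexified.\<close>

definition qrep :: "'d::finite cqmat \<Rightarrow> complex ^ ('d \<times> 4) ^ ('d \<times> 4)" where
  "qrep X = (\<chi> r c. Complex (qmul (fst X $ fst r $ fst c) (axis (snd c) 1) $ snd r)
                          (qmul (snd X $ fst r $ fst c) (axis (snd c) 1) $ snd r))"

text \<open>Complex coordinates on which \<open>qrep\<close> acts, so that matrix equations become
  linear systems, one for each column.\<close>

definition qcol :: "'d::finite cqmat \<Rightarrow> 'd \<Rightarrow> complex ^ ('d \<times> 4)" where
  "qcol Y k = (\<chi> r. Complex (fst Y $ fst r $ k $ snd r) (snd Y $ fst r $ k $ snd r))"

lemma sum_pair_4: "(\<Sum>r\<in>UNIV. f r) = (\<Sum>j\<in>UNIV. \<Sum>b\<in>UNIV. f (j, b))"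
  for f :: "'d::finite \<times> 4 \<Rightarrow> 'a::comm_monoid_add"
  by (simp add: sum.cartesian_product)

lemma qrep_sum:
  fixes X :: "'d::finite cqmat" and u v :: "'d \<Rightarrow> quat"
  shows "(\<Sum>c\<in>UNIV. qrep X $ r $ c * Complex (u (fst c) $ snd c) (v (fst c) $ snd c)) =
    Complex ((\<Sum>j\<in>UNIV. qmul (fst X $ fst r $ j) (u j) - qmul (snd X $ fst r $ j) (v j)) $ snd r)
      ((\<Sum>j\<in>UNIV. qmul (fst X $ fst r $ j) (v j) + qmul (snd X $ fst r $ j) (u j)) $ snd r)"
  by (simp add: complex_eq_iff sum_pair_4 qrep_def sum.distrib sum_subtractf qmul_expand)

lemma qrep_mult_qcol: "qrep X *v qcol Y k = qcol (cqmm X Y) k"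
  unfolding vec_eq_iff matrix_vector_mult_def
  by (simp add: qcol_def qrep_sum[where u = "\<lambda>j. fst Y $ j $ k" and v = "\<lambda>j. snd Y $ j $ k"]
      cqmm_def qmm_def sum.distrib sum_subtractf)

lemma qrep_cqmm: "qrep (cqmm X Y) = qrep X ** qrep Y"
proof -
  have "(qrep X ** qrep Y) $ r $ c = qrep (cqmm X Y) $ r $ c" for r c
  proof -
    define u where "u j = qmul (fst Y $ j $ fst c) (axis (snd c) 1)" for j
    define v where "v j = qmul (snd Y $ j $ fst c) (axis (snd c) 1)" for j
    have "(qrep X ** qrep Y) $ r $ c =
        (\<Sum>k\<in>UNIV. qrep X $ r $ k * Complex (u (fst k) $ snd k) (v (fst k) $ snd k))"
      by (simp add: matrix_matrix_mult_def u_def v_def qrep_def[of Y])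
    also have "\<dots> = qrep (cqmm X Y) $ r $ c"
      unfolding qrep_sum
      by (simp add: u_def v_def qrep_def cqmm_def qmm_def qmul.diff_left qmul.add_left qmul.sum_left qmul_assoc
          sum.distrib sum_subtractf)
    finally show ?thesis .
  qed
  then show ?thesis by (simp add: vec_eq_iff)
qed

text \<open>The columns at index 4 are products with the quaternion unit and return the entries
  themselves.\<close>

lemma qrep_inj: "qrep X = qrep Y \<Longrightarrow> X = Y"
proof -
  assume "qrep X = qrep Y"
  then have "qrep X $ (i, k) $ (j, 4) = qrep Y $ (i, k) $ (j, 4)" for i j k
    by simp
  then show "X = Y"
    by (simp add: qrep_def qmul_unit prod_eq_iff vec_eq_iff)
qed

lemma qrep_cqid: "qrep cqid = mat 1"
proof -
  have axis: "(axis b 1 :: quat) $ a = (if a = b then 1 else 0)" for a b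
    by (simp add: axis_def)
  have "qrep cqid $ (i, a) $ (j, b) = mat 1 $ (i, a) $ (j, b)" for i j :: 'a and a b
    by (cases "i = j") (simp_all add: qrep_def cqid_def mat_def qmul_unit axis qmul.zero_left complex_eq_iff)
  then show ?thesis by (simp add: vec_eq_iff)
qed

lemma qcol_eqI: "(\<And>k. qcol X k = qcol Y k) \<Longrightarrow> X = Y"
proof -
  assume "\<And>k. qcol X k = qcol Y k"
  then have "qcol X k $ (i, b) = qcol Y k $ (i, b)" for i k b
    by simp
  then show "X = Y"
    by (simp add: qcol_def prod_eq_iff vec_eq_iff)
qed

lemma cq_inverse_iff_qrep: "cq_mult X Y = cq_one \<longleftrightarrow> qrep X ** qrep Y = mat 1"
  unfolding cq_mult_eq_cq_one_iff qrep_cqmm[symmetric] qrep_cqid[symmetric]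
  by (auto dest: qrep_inj)

text \<open>Inherited from complex square matrices, where one-sided inverses are two-sided.\<close>

lemma cq_inverse_commute: "cq_mult X Y = cq_one \<longleftrightarrow> cq_mult Y X = cq_one"
  unfolding cq_inverse_iff_qrep by (rule matrix_left_right_inverse)

lemma cq_inverse_iff_columns:
  "cq_mult X Y = cq_one \<longleftrightarrow> (\<forall>k. qrep X *v qcol Y k = qcol cqid k)"
  unfolding cq_mult_eq_cq_one_iff qrep_mult_qcol using qcol_eqI by metis

text \<open>The inverse of \<open>qrep X\<close> is not known in advance to have the form
  \<open>qrep Y\<close>. Applying it to the columns of \<open>cqid\<close> and reading the results
  as the columns of some \<open>Y\<close> gives a right inverse, which suffices by
  \<open>cq_inverse_commute\<close>.\<close>

lemma cq_invertible_iff_det: "cq_invertible X \<longleftrightarrow> det (qrep X) \<noteq> 0"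
proof
  assume "cq_invertible X"
  then obtain Y where "qrep X ** qrep Y = mat 1"
    unfolding cq_invertible_def cq_inverse_iff_qrep by blast
  then have "det (qrep X) * det (qrep Y) = 1"
    by (simp flip: det_mul)
  then show "det (qrep X) \<noteq> 0" by auto
next
  assume "det (qrep X) \<noteq> 0"
  then obtain B where B: "qrep X ** B = mat 1"
    using invertible_det_nz invertible_right_inverse by blast
  define x where "x k = B *v qcol cqid k" for k
  define Y :: "'a cqmat" where "Y = ((\<chi> i k b. Re (x k $ (i, b))), (\<chi> i k b. Im (x k $ (i, b))))"
  have "qcol Y k = x k" for k
    by (simp add: qcol_def Y_def vec_eq_iff)
  then have "qrep X *v qcol Y k = qcol cqid k" for k
    by (simp add: x_def matrix_vector_mul_assoc B)
  then show "cq_invertible X"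
    unfolding cq_invertible_def using cq_inverse_iff_columns cq_inverse_commute by blast
qed

lemma bounded_linear_qrep_entry:
  "bounded_linear (\<lambda>A :: 'd::finite qmat. qmul (A $ i $ j) (axis b 1) $ k)"
  by (intro bounded_linear_intros bounded_linear_compose[OF bounded_linear_vec_nth]
        bounded_linear_compose[OF qmul.bounded_linear_left])

lemma bounded_linear_component: "bounded_linear (\<lambda>A :: 'd::finite qmat. A $ i $ j $ k)"
  by (intro bounded_linear_compose[OF bounded_linear_vec_nth] bounded_linear_vec_nth)

lemma continuous_on_det_qrep: "continuous_on A (\<lambda>X. det (qrep X))"
  unfolding det_def qrep_def vec_lambda_beta Complex_eq
  by (intro continuous_intros bounded_linear.continuous_on[OF bounded_linear_qrep_entry])

section \<open>Matrix-valued Dirichlet series\<close>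

lemma summable_on_sum:
  fixes f :: "'i \<Rightarrow> 'a \<Rightarrow> real"
  assumes "\<And>i. i \<in> I \<Longrightarrow> f i summable_on A"
  shows "(\<lambda>x. \<Sum>i\<in>I. f i x) summable_on A"
  using assms by (induction I rule: infinite_finite_induct) (auto intro: summable_on_add)

lemma D_coeffs_summable:
  assumes \<Lambda>: "additive_semigroup \<Lambda>" and \<omega>: "admissible_weight \<Lambda> \<omega>"
    and a: "a \<in> D_coeffs \<Lambda> \<omega>" and \<phi>: "bounded_linear (\<phi> :: 'd::finite qmat \<Rightarrow> 'b::real_normed_vector)"
  shows "(\<lambda>l. norm (\<phi> (a l)) * \<omega> l) summable_on \<Lambda>"
proof -
  obtain K where K: "0 \<le> K" "\<And>A. norm (\<phi> A) \<le> norm A * K"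
    using bounded_linear.nonneg_bounded[OF \<phi>] by blast
  define C where "C = real (CARD('d) * CARD('d) * 4) * K"
  have \<omega>1: "\<And>l. l \<in> \<Lambda> \<Longrightarrow> 1 \<le> \<omega> l"
    using \<omega> by (auto simp: admissible_weight_def weight_def)
  have "(\<lambda>l. C * (qmat_norm (a l) * \<omega> l)) summable_on \<Lambda>"
    using a by (intro summable_on_cmult_right) (simp add: D_coeffs_def)
  then show ?thesis
  proof (rule summable_on_comparison_test)
    fix l assume l: "l \<in> \<Lambda>"
    have "norm (\<phi> (a l)) \<le> C * qmat_norm (a l)"
      using K(2)[of "a l"] mult_right_mono[OF norm_qmat_le[of "a l"] K(1)] by (simp add: C_def mult_ac)
    from mult_right_mono[OF this, of "\<omega> l"] \<omega>1[OF l]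
    show "norm (\<phi> (a l)) * \<omega> l \<le> C * (qmat_norm (a l) * \<omega> l)" by (simp add: mult_ac)
    show "0 \<le> norm (\<phi> (a l)) * \<omega> l" using \<omega>1[OF l] by simp
  qed
qed

text \<open>\<open>t\<close> stands for \<open>Re\<close> or \<open>Im\<close>, so that one estimate
  serves both components of \<open>dirichlet_eval\<close>.\<close>

lemma dirichlet_eval_summable:
  assumes \<Lambda>: "additive_semigroup \<Lambda>" and \<omega>: "admissible_weight \<Lambda> \<omega>"
    and a: "a \<in> D_coeffs \<Lambda> \<omega>" and s: "0 \<le> Re s" and t: "\<And>z. \<bar>t z\<bar> \<le> norm z"
  shows "(\<lambda>l. norm (t (exp (- (complex_of_real l * s))) *\<^sub>R (a l :: 'd::finite qmat))) summable_on \<Lambda>"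
    and "norm (\<Sum>\<^sub>\<infinity>l\<in>\<Lambda>. t (exp (- (complex_of_real l * s))) *\<^sub>R a l) \<le> (\<Sum>\<^sub>\<infinity>l\<in>\<Lambda>. norm (a l) * \<omega> l)"
proof -
  have \<omega>1: "\<And>l. l \<in> \<Lambda> \<Longrightarrow> 1 \<le> \<omega> l" and \<Lambda>0: "\<And>l. l \<in> \<Lambda> \<Longrightarrow> 0 \<le> l"
    using \<omega> \<Lambda> by (auto simp: admissible_weight_def weight_def additive_semigroup_def)
  have sm: "(\<lambda>l. norm (a l) * \<omega> l) summable_on \<Lambda>"
    using D_coeffs_summable[OF \<Lambda> \<omega> a bounded_linear_ident] by simp
  have le: "norm (t (exp (- (complex_of_real l * s))) *\<^sub>R a l) \<le> norm (a l) * \<omega> l" if l: "l \<in> \<Lambda>" for l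
  proof -
    have "\<bar>t (exp (- (complex_of_real l * s)))\<bar> \<le> exp (- (l * Re s))"
      using t[of "exp (- (complex_of_real l * s))"] by simp
    also have "\<dots> \<le> 1" using \<Lambda>0[OF l] s by simp
    also have "\<dots> \<le> \<omega> l" by (rule \<omega>1[OF l])
    finally have "\<bar>t (exp (- (complex_of_real l * s)))\<bar> \<le> \<omega> l" .
    from mult_right_mono[OF this norm_ge_zero[of "a l"]] show ?thesis
      by (simp add: mult.commute)
  qed
  show 1: "(\<lambda>l. norm (t (exp (- (complex_of_real l * s))) *\<^sub>R a l)) summable_on \<Lambda>"
    by (rule Infinite_Sum.abs_summable_on_comparison_test'[OF sm le])
  show "norm (\<Sum>\<^sub>\<infinity>l\<in>\<Lambda>. t (exp (- (complex_of_real l * s))) *\<^sub>R a l) \<le> (\<Sum>\<^sub>\<infinity>l\<in>\<Lambda>. norm (a l) * \<omega> l)"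
    by (rule order_trans[OF norm_infsum_bound[OF 1] infsum_mono[OF 1 sm le]])
qed

lemma dirichlet_eval_bounded:
  assumes \<Lambda>: "additive_semigroup \<Lambda>" and \<omega>: "admissible_weight \<Lambda> \<omega>"
    and a: "a \<in> D_coeffs \<Lambda> \<omega>"
  shows "bounded (dirichlet_eval \<Lambda> a ` right_half_plane)"
proof -
  define B where "B = (\<Sum>\<^sub>\<infinity>l\<in>\<Lambda>. norm (a l) * \<omega> l)"
  have "norm (dirichlet_eval \<Lambda> a s) \<le> B + B" if "0 \<le> Re s" for s
    using norm_Pair_le[of "fst (dirichlet_eval \<Lambda> a s)" "snd (dirichlet_eval \<Lambda> a s)"]
      dirichlet_eval_summable(2)[OF \<Lambda> \<omega> a that abs_Re_le_cmod]
      dirichlet_eval_summable(2)[OF \<Lambda> \<omega> a that abs_Im_le_cmod]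
    by (simp add: dirichlet_eval_def B_def)
  then show ?thesis
    by (auto simp: bounded_iff right_half_plane_def)
qed

text \<open>The real and imaginary parts of the exponential multiply the same real number
  \<open>\<phi> (a l)\<close>, so the two components recombine into one scalar series.\<close>

lemma dirichlet_eval_has_sum:
  assumes \<Lambda>: "additive_semigroup \<Lambda>" and \<omega>: "admissible_weight \<Lambda> \<omega>"
    and a: "a \<in> D_coeffs \<Lambda> \<omega>" and \<phi>: "bounded_linear (\<phi> :: 'd::finite qmat \<Rightarrow> real)"
    and s: "0 \<le> Re s"
  shows "((\<lambda>l. of_real (\<phi> (a l)) * exp (- (of_real l * s))) has_sum
      Complex (\<phi> (fst (dirichlet_eval \<Lambda> a s))) (\<phi> (snd (dirichlet_eval \<Lambda> a s)))) \<Lambda>"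
proof -
  have part: "((\<lambda>l. t (exp (- (complex_of_real l * s))) * \<phi> (a l)) has_sum
      \<phi> (\<Sum>\<^sub>\<infinity>l\<in>\<Lambda>. t (exp (- (complex_of_real l * s))) *\<^sub>R a l)) \<Lambda>"
    if t: "\<And>z. \<bar>t z\<bar> \<le> norm z" for t
    using has_sum_bounded_linear[OF \<phi> has_sum_infsum[OF
        abs_summable_summable[OF dirichlet_eval_summable(1)[OF \<Lambda> \<omega> a s t]]]]
    by (simp add: bounded_linear.linear[OF \<phi>] linear_cmul)
  have "((\<lambda>l. complex_of_real (Re (exp (- (complex_of_real l * s))) * \<phi> (a l)) +
        \<i> * complex_of_real (Im (exp (- (complex_of_real l * s))) * \<phi> (a l))) has_sum
      complex_of_real (\<phi> (fst (dirichlet_eval \<Lambda> a s))) +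
        \<i> * complex_of_real (\<phi> (snd (dirichlet_eval \<Lambda> a s)))) \<Lambda>"
    unfolding dirichlet_eval_def fst_conv snd_conv
    by (intro has_sum_add has_sum_cmult_right has_sum_of_real part abs_Re_le_cmod abs_Im_le_cmod)
  moreover have "complex_of_real (Re z * x) + \<i> * complex_of_real (Im z * x) = of_real x * z" for z x
    by (simp add: complex_eq_iff)
  ultimately show ?thesis
    by (simp add: Complex_eq)
qed

lemma dirichlet_eval_dirichlet_bounded:
  assumes \<Lambda>: "additive_semigroup \<Lambda>" and \<omega>: "admissible_weight \<Lambda> \<omega>"
    and a: "a \<in> D_coeffs \<Lambda> \<omega>" and \<phi>: "bounded_linear (\<phi> :: 'd::finite qmat \<Rightarrow> real)"
  shows "\<exists>N. dirichlet_bounded \<Lambda> \<omega> 0 N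
     (\<lambda>s. Complex (\<phi> (fst (dirichlet_eval \<Lambda> a s))) (\<phi> (snd (dirichlet_eval \<Lambda> a s))))"
  unfolding dirichlet_bounded_def
  using dirichlet_eval_has_sum[OF \<Lambda> \<omega> a \<phi>] has_sum_infsum[OF D_coeffs_summable[OF \<Lambda> \<omega> a \<phi>]]
  by (intro exI[of _ "infsum (\<lambda>l. norm (\<phi> (a l)) * \<omega> l) \<Lambda>"] exI[of _ "\<lambda>l. of_real (\<phi> (a l))"]) auto

text \<open>By the Leibniz formula the determinant is a polynomial in the entries.\<close>

lemma (in dirichlet_weight) dirichlet_bounded_det:
  fixes F :: "complex \<Rightarrow> complex ^ 'n ^ 'n"
  assumes "\<And>i j. \<exists>N. dirichlet_bounded \<Lambda> w \<sigma> N (\<lambda>s. F s $ i $ j)"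
  shows "\<exists>N. dirichlet_bounded \<Lambda> w \<sigma> N (\<lambda>s. det (F s))"
  unfolding det_def
proof (rule dirichlet_bounded_sum)
  show "finite {p. p permutes (UNIV :: 'n set)}" by (rule finite_permutations) simp
  fix p
  obtain N where "dirichlet_bounded \<Lambda> w \<sigma> N (\<lambda>s. \<Prod>i\<in>UNIV. F s $ i $ p i)"
    using dirichlet_bounded_prod[of UNIV "\<lambda>i s. F s $ i $ p i"] assms by auto
  from dirichlet_bounded_mult[OF dirichlet_bounded_const this]
  show "\<exists>N. dirichlet_bounded \<Lambda> w \<sigma> N (\<lambda>s. of_int (sign p) * (\<Prod>i\<in>UNIV. F s $ i $ p i))"
    by blast
qed

lemma det_qrep_dirichlet_bounded:
  fixes a :: "real \<Rightarrow> 'd::finite qmat"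
  assumes \<Lambda>: "additive_semigroup \<Lambda>" and \<omega>: "admissible_weight \<Lambda> \<omega>"
    and a: "a \<in> D_coeffs \<Lambda> \<omega>"
  shows "\<exists>N. dirichlet_bounded \<Lambda> \<omega> 0 N (\<lambda>s. qrep (dirichlet_eval \<Lambda> a s) $ r $ c)"
    and "\<exists>N. dirichlet_bounded \<Lambda> \<omega> 0 N (\<lambda>s. det (qrep (dirichlet_eval \<Lambda> a s)))"
proof -
  interpret dirichlet_weight \<Lambda> \<omega> 0
    by (rule admissible_dirichlet_weight[OF \<Lambda> \<omega>])
  show 1: "\<exists>N. dirichlet_bounded \<Lambda> \<omega> 0 N (\<lambda>s. qrep (dirichlet_eval \<Lambda> a s) $ r $ c)" for r c
    using dirichlet_eval_dirichlet_bounded[OF \<Lambda> \<omega> a bounded_linear_qrep_entry] by (simp add: qrep_def)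
  show "\<exists>N. dirichlet_bounded \<Lambda> \<omega> 0 N (\<lambda>s. det (qrep (dirichlet_eval \<Lambda> a s)))"
    by (rule dirichlet_bounded_det[OF 1])
qed

text \<open>The coefficients contain no central imaginary unit, so conjugating \<open>s\<close> only
  conjugates the exponentials.\<close>

lemma dirichlet_eval_cnj:
  "fst (dirichlet_eval \<Lambda> a (cnj s)) = fst (dirichlet_eval \<Lambda> a s)"
  "snd (dirichlet_eval \<Lambda> a (cnj s)) = - snd (dirichlet_eval \<Lambda> a s)"
proof -
  have "exp (- (complex_of_real l * cnj s)) = cnj (exp (- (complex_of_real l * s)))" for l
    by (simp add: exp_cnj)
  then show "fst (dirichlet_eval \<Lambda> a (cnj s)) = fst (dirichlet_eval \<Lambda> a s)"
    "snd (dirichlet_eval \<Lambda> a (cnj s)) = - snd (dirichlet_eval \<Lambda> a s)"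
    by (simp_all add: dirichlet_eval_def infsum_uminus)
qed

lemma qrep_dirichlet_eval_cnj:
  "qrep (dirichlet_eval \<Lambda> a s) $ r $ c = cnj (qrep (dirichlet_eval \<Lambda> a (cnj s)) $ r $ c)"
  by (simp add: qrep_def dirichlet_eval_cnj qmul.minus_left complex_eq_iff)

text \<open>
  Cramer's rule yields an inverse \<open>G\<close> with complex coefficients. Since \<open>F s\<close> is the entrywise
  conjugate of \<open>F (cnj s)\<close>, the function \<open>s \<mapsto> cnj (G (cnj s))\<close> is an inverse as well, and the mean
  of the two has the real parts of the coefficients of \<open>G\<close> as coefficients.
\<close>
lemma exists_real_dirichlet_inverse:
  fixes a :: "real \<Rightarrow> 'd::finite qmat"
  assumes \<Lambda>: "additive_semigroup \<Lambda>" and \<omega>: "admissible_weight \<Lambda> \<omega>"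
    and a: "a \<in> D_coeffs \<Lambda> \<omega>" and \<delta>: "0 < \<delta>"
    and lower: "\<And>s. 0 \<le> Re s \<Longrightarrow> \<delta> \<le> norm (det (qrep (dirichlet_eval \<Lambda> a s)))"
  shows "\<exists>b\<in>D_coeffs \<Lambda> \<omega>. \<forall>s. 0 \<le> Re s \<longrightarrow>
     cq_mult (dirichlet_eval \<Lambda> a s) (dirichlet_eval \<Lambda> b s) = cq_one"
proof -
  interpret dirichlet_weight \<Lambda> \<omega> 0
    by (rule admissible_dirichlet_weight[OF \<Lambda> \<omega>])
  define F where "F s = qrep (dirichlet_eval \<Lambda> a s)" for s
  define e :: "'d \<Rightarrow> complex ^ ('d \<times> 4)" where "e k = qcol cqid k" for k
  \<comment> \<open>Cramer quotients for the system with right-hand side \<open>e k\<close>.\<close>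
  define G where "G k s = (\<chi> r. det (\<chi> i j. if j = r then e k $ i else F s $ i $ j) / det (F s))" for k s
  have G: "F s *v G k s = e k" if "0 \<le> Re s" for k s
  proof -
    have "det (F s) \<noteq> 0" using lower[OF that] \<delta> by (auto simp: F_def)
    from cramer[OF this, of "G k s" "e k"] show ?thesis by (simp add: G_def)
  qed
  obtain N where "dirichlet_bounded \<Lambda> \<omega> 0 N (\<lambda>s. det (F s))"
    using det_qrep_dirichlet_bounded(2)[OF \<Lambda> \<omega> a] unfolding F_def by blast
  then obtain N' where N': "dirichlet_bounded \<Lambda> \<omega> 0 N' (\<lambda>s. inverse (det (F s)))"
    using dirichlet_bounded_inverse[OF \<Lambda> \<omega> _ \<delta>] lower unfolding F_def by blast
  have G_bounded: "\<exists>N. dirichlet_bounded \<Lambda> \<omega> 0 N (\<lambda>s. G k s $ r)" for k r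
  proof -
    have "\<exists>N. dirichlet_bounded \<Lambda> \<omega> 0 N (\<lambda>s. (\<chi> i j. if j = r then e k $ i else F s $ i $ j) $ i $ j)" for i j
      using det_qrep_dirichlet_bounded(1)[OF \<Lambda> \<omega> a, of i j] dirichlet_bounded_const[of "e k $ i"]
      by (cases "j = r") (auto simp: F_def)
    from dirichlet_bounded_det[OF this] obtain N where
      "dirichlet_bounded \<Lambda> \<omega> 0 N (\<lambda>s. det (\<chi> i j. if j = r then e k $ i else F s $ i $ j))" ..
    from dirichlet_bounded_mult[OF this N'] show ?thesis
      by (auto simp: G_def divide_inverse)
  qed
  \<comment> \<open>Stated as a predicate so that coefficients can be chosen for all
    \<open>k\<close> and \<open>r\<close> at once.\<close>
  define coeffs where "coeffs k r c \<longleftrightarrow> (\<lambda>l. norm (c l) * \<omega> l) summable_on \<Lambda> \<and>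
      (\<forall>s. 0 \<le> Re s \<longrightarrow> ((\<lambda>l. c l * exp (- (of_real l * s))) has_sum G k s $ r) \<Lambda>)" for k r c
  have "\<exists>c. coeffs k r c" for k r
    using G_bounded[of k r] unfolding dirichlet_bounded_def coeffs_def
    by (meson has_sum_imp_summable)
  then have "coeffs k r (SOME c. coeffs k r c)" for k r
    by (rule someI_ex)
  then obtain c where "\<And>k r. coeffs k r (c k r)"
    by (rule that[of "\<lambda>k r. SOME c. coeffs k r c"])
  then have c: "(\<lambda>l. norm (c k r l) * \<omega> l) summable_on \<Lambda>"
    "0 \<le> Re s \<Longrightarrow> ((\<lambda>l. c k r l * exp (- (of_real l * s))) has_sum G k s $ r) \<Lambda>" for k r s
    unfolding coeffs_def by blast+
  \<comment> \<open>The value 0 outside \<open>\<Lambda>\<close> is what \<open>D_coeffs\<close>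
    demands; the chosen \<open>c\<close> is arbitrary there.\<close>
  define b :: "real \<Rightarrow> 'd qmat" where
    "b l = (if l \<in> \<Lambda> then (\<chi> i k m. Re (c k (i, m) l)) else 0)" for l
  have b: "b \<in> D_coeffs \<Lambda> \<omega>"
  proof -
    obtain K where K: "0 \<le> K" "\<And>A :: 'd qmat.
        qmat_norm A \<le> K * (\<Sum>i\<in>UNIV. \<Sum>j\<in>UNIV. \<Sum>k\<in>UNIV. \<bar>A $ i $ j $ k\<bar>)"
      using qmat_norm_le by blast
    have "(\<lambda>l. K * (\<Sum>i\<in>UNIV. \<Sum>j\<in>UNIV. \<Sum>k\<in>UNIV. norm (c j (i, k) l) * \<omega> l)) summable_on \<Lambda>"
      by (intro summable_on_cmult_right summable_on_sum c(1))
    then have "(\<lambda>l. qmat_norm (b l) * \<omega> l) summable_on \<Lambda>"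
    proof (rule summable_on_comparison_test)
      fix l assume l: "l \<in> \<Lambda>"
      show "0 \<le> qmat_norm (b l) * \<omega> l"
        using weight_pos[OF l] qmat_norm_nonneg[of "b l"] by simp
      have "qmat_norm (b l) \<le> K * (\<Sum>i\<in>UNIV. \<Sum>j\<in>UNIV. \<Sum>k\<in>UNIV. \<bar>b l $ i $ j $ k\<bar>)"
        by (rule K(2))
      also have "\<dots> \<le> K * (\<Sum>i\<in>UNIV. \<Sum>j\<in>UNIV. \<Sum>k\<in>UNIV. norm (c j (i, k) l))"
        by (intro mult_left_mono sum_mono K(1)) (simp add: b_def l abs_Re_le_cmod)
      finally have "qmat_norm (b l) * \<omega> l \<le>
          K * (\<Sum>i\<in>UNIV. \<Sum>j\<in>UNIV. \<Sum>k\<in>UNIV. norm (c j (i, k) l)) * \<omega> l"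
        using weight_pos[OF l] by (intro mult_right_mono) auto
      then show "qmat_norm (b l) * \<omega> l \<le>
          K * (\<Sum>i\<in>UNIV. \<Sum>j\<in>UNIV. \<Sum>k\<in>UNIV. norm (c j (i, k) l) * \<omega> l)"
        by (simp only: sum_distrib_right mult.assoc)
    qed
    then show ?thesis by (simp add: D_coeffs_def b_def)
  qed
  have "cq_mult (dirichlet_eval \<Lambda> a s) (dirichlet_eval \<Lambda> b s) = cq_one" if s: "0 \<le> Re s" for s
    unfolding cq_inverse_iff_columns
  proof
    fix k
    \<comment> \<open>The reflected solution solves the same system because \<open>e k\<close> has
      real entries.\<close>
    define H where "H = (\<chi> r. cnj (G k (cnj s) $ r))"
    have "(F s *v H) $ r = e k $ r" for r
    proof -
      have "(F s *v H) $ r = cnj ((F (cnj s) *v G k (cnj s)) $ r)"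
        unfolding matrix_vector_mult_def F_def
        by (subst qrep_dirichlet_eval_cnj) (simp add: H_def)
      also have "\<dots> = cnj (e k $ r)"
        using G[of "cnj s" k] s by simp
      also have "\<dots> = e k $ r"
        by (simp add: e_def qcol_def cqid_def complex_eq_iff)
      finally show ?thesis .
    qed
    then have H: "F s *v H = e k" by (simp add: vec_eq_iff)
    \<comment> \<open>Termwise this is \<open>2 * Re z = z + cnj z\<close> for the coefficients;
      keeping the factor 2 avoids division.\<close>
    have col: "2 * (qcol (dirichlet_eval \<Lambda> b s) k $ r) = G k s $ r + H $ r" for r
    proof -
      obtain i m where r: "r = (i, m)" by (cases r)
      have "((\<lambda>l. 2 * (of_real (b l $ i $ k $ m) * exp (- (of_real l * s)))) has_sum
          2 * (qcol (dirichlet_eval \<Lambda> b s) k $ r)) \<Lambda>"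
        using has_sum_cmult_right[OF dirichlet_eval_has_sum[OF \<Lambda> \<omega> b bounded_linear_component s]]
        by (simp add: qcol_def r)
      moreover have "((\<lambda>l. c k r l * exp (- (of_real l * s)) + cnj (c k r l * exp (- (of_real l * cnj s))))
          has_sum G k s $ r + H $ r) \<Lambda>"
        using s by (auto simp: H_def has_sum_cnj_iff intro!: has_sum_add c(2) simp del: complex_cnj_mult)
      moreover have "c k r l * exp (- (of_real l * s)) + cnj (c k r l * exp (- (of_real l * cnj s))) =
          2 * (of_real (b l $ i $ k $ m) * exp (- (of_real l * s)))" if "l \<in> \<Lambda>" for l
      proof -
        have conj: "cnj (c k r l * exp (- (of_real l * cnj s))) = cnj (c k r l) * exp (- (of_real l * s))"
          by (simp add: exp_cnj)
        have b: "2 * complex_of_real (b l $ i $ k $ m) = c k r l + cnj (c k r l)"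
          by (simp add: b_def that r complex_add_cnj)
        show ?thesis
          unfolding conj mult.assoc[symmetric] b by (rule distrib_right[symmetric])
      qed
      ultimately show ?thesis
        using has_sum_unique by (metis (no_types, lifting) has_sum_cong)
    qed
    have "2 * ((F s *v qcol (dirichlet_eval \<Lambda> b s) k) $ r) = 2 * (e k $ r)" for r
    proof -
      have "2 * ((F s *v qcol (dirichlet_eval \<Lambda> b s) k) $ r) =
          (\<Sum>j\<in>UNIV. F s $ r $ j * (2 * (qcol (dirichlet_eval \<Lambda> b s) k $ j)))"
        by (simp add: matrix_vector_mult_def sum_distrib_left mult_ac)
      also have "\<dots> = (F s *v G k s) $ r + (F s *v H) $ r"
        unfolding col by (simp add: matrix_vector_mult_def sum.distrib distrib_left)
      finally show ?thesis by (simp add: G[OF s] H)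
    qed
    then show "qrep (dirichlet_eval \<Lambda> a s) *v qcol (dirichlet_eval \<Lambda> b s) k = qcol cqid k"
      by (simp add: F_def e_def vec_eq_iff)
  qed
  with b show ?thesis by blast
qed

theorem mainTheorem9:
  fixes \<Lambda> :: "real set" and \<omega> :: "real \<Rightarrow> real" and f :: "complex \<Rightarrow> 'd::finite cqmat"
  assumes "additive_semigroup \<Lambda>"
    and "admissible_weight \<Lambda> \<omega>"
    and "f \<in> D_alg \<Lambda> \<omega>"
  shows "(\<exists>g\<in>D_alg \<Lambda> \<omega>. \<forall>s\<in>right_half_plane.
            cq_mult (f s) (g s) = cq_one \<and> cq_mult (g s) (f s) = cq_one)
     \<longleftrightarrow> closure (f ` right_half_plane) \<subseteq> {X. cq_invertible X}"
proof
  obtain a where a: "a \<in> D_coeffs \<Lambda> \<omega>" and f: "f = dirichlet_eval \<Lambda> a"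
    using assms(3) by (auto simp: D_alg_def)
  interpret dirichlet_weight \<Lambda> \<omega> 0
    by (rule admissible_dirichlet_weight[OF assms(1,2)])
  {
    assume "\<exists>g\<in>D_alg \<Lambda> \<omega>. \<forall>s\<in>right_half_plane.
      cq_mult (f s) (g s) = cq_one \<and> cq_mult (g s) (f s) = cq_one"
    then obtain b where b: "b \<in> D_coeffs \<Lambda> \<omega>"
      and inv: "\<And>s. 0 \<le> Re s \<Longrightarrow> cq_mult (f s) (dirichlet_eval \<Lambda> b s) = cq_one"
      by (auto simp: D_alg_def right_half_plane_def)
    obtain N where N: "dirichlet_bounded \<Lambda> \<omega> 0 N (\<lambda>s. det (qrep (dirichlet_eval \<Lambda> b s)))"
      using det_qrep_dirichlet_bounded(2)[OF assms(1,2) b] by blast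
    \<comment> \<open>On the range, the determinants of \<open>f s\<close> and of its inverse
      multiply to 1 and the latter is bounded by \<open>N\<close>. The resulting inequality is
      closed, hence survives on the closure and forces a nonzero determinant.\<close>
    have "1 \<le> N * norm (det (qrep X))" if X: "X \<in> closure (f ` right_half_plane)" for X
    proof (rule continuous_ge_on_closure[OF _ X])
      show "continuous_on (closure (f ` right_half_plane)) (\<lambda>X. N * norm (det (qrep X)))"
        by (intro continuous_intros continuous_on_det_qrep)
      fix Y assume "Y \<in> f ` right_half_plane"
      then obtain s where s: "0 \<le> Re s" and Y: "Y = f s"
        by (auto simp: right_half_plane_def)
      have "det (qrep (f s)) * det (qrep (dirichlet_eval \<Lambda> b s)) = 1"
        using inv[OF s] by (simp add: cq_inverse_iff_qrep flip: det_mul)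
      then have "1 = norm (det (qrep (f s))) * norm (det (qrep (dirichlet_eval \<Lambda> b s)))"
        by (simp flip: norm_mult)
      also have "\<dots> \<le> norm (det (qrep (f s))) * N"
        by (intro mult_left_mono dirichlet_bounded_norm_le[OF N s]) simp
      finally show "1 \<le> N * norm (det (qrep Y))"
        by (simp add: Y mult.commute)
    qed
    then show "closure (f ` right_half_plane) \<subseteq> {X. cq_invertible X}"
      by (force simp: cq_invertible_iff_det)
  }
  assume inv: "closure (f ` right_half_plane) \<subseteq> {X. cq_invertible X}"
  \<comment> \<open>The range is bounded in a finite-dimensional space, so the norm of the
    determinant attains a minimum on the closure. By invertibility this minimum is positive, and it
    serves as the uniform lower bound \<delta>.\<close>
  have "compact (closure (f ` right_half_plane))"
    using dirichlet_eval_bounded[OF assms(1,2) a] by (simp add: f compact_closure)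
  moreover have "0 \<in> right_half_plane"
    by (simp add: right_half_plane_def)
  then have "closure (f ` right_half_plane) \<noteq> {}" by auto
  moreover have "continuous_on (closure (f ` right_half_plane)) (\<lambda>X. norm (det (qrep X)))"
    by (intro continuous_intros continuous_on_det_qrep)
  ultimately obtain X where X: "X \<in> closure (f ` right_half_plane)"
    and min: "\<And>Y. Y \<in> closure (f ` right_half_plane) \<Longrightarrow> norm (det (qrep X)) \<le> norm (det (qrep Y))"
    using continuous_attains_inf[of "closure (f ` right_half_plane)" "\<lambda>X. norm (det (qrep X))"] by blast
  have "0 < norm (det (qrep X))"
    using X inv cq_invertible_iff_det[of X] by auto
  moreover have "norm (det (qrep X)) \<le> norm (det (qrep (dirichlet_eval \<Lambda> a s)))" if "0 \<le> Re s" for s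
    using that closure_subset[of "f ` right_half_plane"]
    by (intro min) (auto simp: f right_half_plane_def)
  ultimately obtain b where b: "b \<in> D_coeffs \<Lambda> \<omega>"
    and right: "\<And>s. 0 \<le> Re s \<Longrightarrow> cq_mult (f s) (dirichlet_eval \<Lambda> b s) = cq_one"
    using exists_real_dirichlet_inverse[OF assms(1,2) a] unfolding f by blast
  have left: "cq_mult (dirichlet_eval \<Lambda> b s) (f s) = cq_one" if "0 \<le> Re s" for s
    using right[OF that] by (rule cq_inverse_commute[THEN iffD1])
  show "\<exists>g\<in>D_alg \<Lambda> \<omega>. \<forall>s\<in>right_half_plane.
      cq_mult (f s) (g s) = cq_one \<and> cq_mult (g s) (f s) = cq_one"
    using b right left
    by (intro bexI[of _ "dirichlet_eval \<Lambda> b"]) (auto simp: D_alg_def right_half_plane_def)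
qed

end
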